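(* Let $d\ge 3$ be odd and let $k$ be even. Then $g_d(n,k)>0$ for all $n\le 2^{d-1}$.
   Context: For partitions $\mu^{(1)},\ldots,\mu^{(d)}$ of the same integer $N$, the (generalized) Kronecker coefficient $g(\mu^{(1)},\ldots,\mu^{(d)})$ is the multiplicity of the trivial representation $[(N)]$ in $[\mu^{(1)}]\otimes\cdots\otimes[\mu^{(d)}]$, where $[\mu]$ is the irreducible complex representation of the symmetric group $S_N$ indexed by $\mu$. For nonnegative integers $n$ and positive integers $k$, $n\times k:=(k,\ldots,k)$ ($n$ parts equal to $k$) and $g_d(n,k):=g(n\times k,\ldots,n\times k)$ ($d$ times), the rectangular Kronecker coefficient; $g_d(0,k)=1$. *)

theory Defs
  imports Complex_Main "HOL-Library.FuncSet" "HOL-Library.Function_Algebras"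
    "HOL-Combinatorics.Permutations"
begin

definition cscale :: "complex \<Rightarrow> ('x \<Rightarrow> complex) \<Rightarrow> 'x \<Rightarrow> complex" where
  "cscale c f = (\<lambda>x. c * f x)"

global_interpretation cfun: vector_space cscale
  by unfold_locales (auto simp: cscale_def fun_eq_iff algebra_simps)


subsection \<open>Complex representations of the symmetric group\<close>

text \<open>
  The symmetric group $S_N$ is the set of all \<open>p\<close> with \<open>p permutes {..<N}\<close>. A representation of it is
  given by a subspace \<open>V\<close> of some \<open>'x \<Rightarrow> complex\<close> together with an action
  \<open>\<rho> p\<close> of each \<open>p\<close>.
\<close>

type_synonym 'x action = "(nat \<Rightarrow> nat) \<Rightarrow> ('x \<Rightarrow> complex) \<Rightarrow> 'x \<Rightarrow> complex"

definition stable_subspace :: "nat \<Rightarrow> 'x action \<Rightarrow> ('x \<Rightarrow> complex) set \<Rightarrow> bool" where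
  "stable_subspace N \<rho> U \<longleftrightarrow>
     cfun.subspace U \<and> (\<forall>p. p permutes {..<N} \<longrightarrow> \<rho> p ` U \<subseteq> U)"

definition irreducible_rep :: "nat \<Rightarrow> 'x action \<Rightarrow> ('x \<Rightarrow> complex) set \<Rightarrow> bool" where
  "irreducible_rep N \<rho> U \<longleftrightarrow>
     stable_subspace N \<rho> U \<and> U \<noteq> {0} \<and>
     (\<forall>U'. stable_subspace N \<rho> U' \<and> U' \<subseteq> U \<longrightarrow> U' = {0} \<or> U' = U)"

definition isomorphic_rep ::
    "nat \<Rightarrow> 'x action \<Rightarrow> ('x \<Rightarrow> complex) set \<Rightarrow> 'y action \<Rightarrow> ('y \<Rightarrow> complex) set \<Rightarrow> bool" where
  "isomorphic_rep N \<rho> U \<sigma> W \<longleftrightarrow>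
     (\<exists>\<phi>. Vector_Spaces.linear cscale cscale \<phi> \<and> bij_betw \<phi> U W \<and>
          (\<forall>p u. p permutes {..<N} \<and> u \<in> U \<longrightarrow> \<phi> (\<rho> p u) = \<sigma> p (\<phi> u)))"

definition irreducible_decomposition ::
    "nat \<Rightarrow> 'x action \<Rightarrow> ('x \<Rightarrow> complex) set \<Rightarrow> nat \<Rightarrow> (nat \<Rightarrow> ('x \<Rightarrow> complex) set) \<Rightarrow> bool" where
  "irreducible_decomposition N \<rho> V m U \<longleftrightarrow>
     (\<forall>i<m. irreducible_rep N \<rho> (U i)) \<and>
     bij_betw (\<lambda>u. \<Sum>i<m. u i) (\<Pi>\<^sub>E i\<in>{..<m}. U i) V"

text \<open>
  The multiplicity of the irreducible representation \<open>W\<close> (with action \<open>\<sigma>\<close>) in \<open>V\<close> (with action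
  \<open>\<rho>\<close>). The number of summands does not depend on the decomposition.
\<close>

definition multiplicity_rep ::
    "nat \<Rightarrow> 'y action \<Rightarrow> ('y \<Rightarrow> complex) set \<Rightarrow> 'x action \<Rightarrow> ('x \<Rightarrow> complex) set \<Rightarrow> nat" where
  "multiplicity_rep N \<sigma> W \<rho> V =
     (THE c. \<exists>m U. irreducible_decomposition N \<rho> V m U \<and>
                   c = card {i. i < m \<and> isomorphic_rep N \<rho> (U i) \<sigma> W})"


subsection \<open>Specht modules\<close>

text \<open>
  A partition is the weakly decreasing list of its positive parts; rows, columns and the entries
  of tableaux are numbered from \<open>0\<close>. A tabloid with \<open>N\<close> entries is encoded as the list of length
  \<open>N\<close> whose element at position \<open>x\<close> is the row containing the entry \<open>x\<close>. The permutation module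
  on tabloids thus consists of complex functions on lists.
\<close>

definition young_diagram :: "nat list \<Rightarrow> (nat \<times> nat) set" where
  "young_diagram \<mu> = {(i, j). i < length \<mu> \<and> j < \<mu> ! i}"

definition tableau :: "nat list \<Rightarrow> (nat \<times> nat \<Rightarrow> nat) \<Rightarrow> bool" where
  "tableau \<mu> t \<longleftrightarrow> bij_betw t (young_diagram \<mu>) {..<sum_list \<mu>}"

definition tabloid :: "nat list \<Rightarrow> (nat \<times> nat \<Rightarrow> nat) \<Rightarrow> nat list" where
  "tabloid \<mu> t = map (\<lambda>x. fst (inv_into (young_diagram \<mu>) t x)) [0..<sum_list \<mu>]"

definition column_group :: "nat list \<Rightarrow> (nat \<times> nat \<Rightarrow> nat) \<Rightarrow> (nat \<Rightarrow> nat) set" where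
  "column_group \<mu> t =
     {p. p permutes {..<sum_list \<mu>} \<and>
         (\<forall>(i, j) \<in> young_diagram \<mu>. \<exists>i'. (i', j) \<in> young_diagram \<mu> \<and> p (t (i, j)) = t (i', j))}"

definition polytabloid :: "nat list \<Rightarrow> (nat \<times> nat \<Rightarrow> nat) \<Rightarrow> nat list \<Rightarrow> complex" where
  "polytabloid \<mu> t =
     (\<lambda>w. \<Sum>p\<in>column_group \<mu> t. of_int (sign p) * (if w = tabloid \<mu> (p \<circ> t) then 1 else 0))"

definition specht_module :: "nat list \<Rightarrow> (nat list \<Rightarrow> complex) set" where
  "specht_module \<mu> = cfun.span (polytabloid \<mu> ` {t. tableau \<mu> t})"

text \<open>
  \<open>permute_list (inv p)\<close> moves the element at position \<open>x\<close> to position \<open>p x\<close>, so it sends the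
  tabloid of \<open>t\<close> to that of \<open>p \<circ> t\<close>. The induced left action on functions composes with its inverse,
  which is \<open>permute_list p\<close>.
\<close>

definition tabloid_action :: "nat list action" where
  "tabloid_action p f = (\<lambda>w. f (permute_list p w))"


subsection \<open>Tensor products and Kronecker coefficients\<close>

text \<open>
  The tensor product of subspaces $V_1, \dots, V_d$ of \<open>'x \<Rightarrow> complex\<close>, realised inside the functions
  on $d$-tuples (lists of length $d$) by identifying $f_1 \otimes \dots \otimes f_d$ with
  $(x_1, \dots, x_d) \mapsto f_1(x_1) \cdots f_d(x_d)$.
\<close>

definition elementary_tensor :: "('x \<Rightarrow> complex) list \<Rightarrow> 'x list \<Rightarrow> complex" where
  "elementary_tensor fs =
     (\<lambda>xs. if length xs = length fs then \<Prod>i<length fs. (fs ! i) (xs ! i) else 0)"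

definition tensor_product :: "('x \<Rightarrow> complex) set list \<Rightarrow> ('x list \<Rightarrow> complex) set" where
  "tensor_product Vs = cfun.span (elementary_tensor ` {fs. list_all2 (\<in>) fs Vs})"

text \<open>
  The diagonal action: it sends $f_1 \otimes \dots \otimes f_d$ to
  $p f_1 \otimes \dots \otimes p f_d$, where each $p f_i$ is given by \<open>tabloid_action\<close>.
\<close>

definition diagonal_action :: "nat list list action" where
  "diagonal_action p F = (\<lambda>ws. F (map (permute_list p) ws))"

text \<open>
  \<open>\<mu>s\<close> is a list of partitions of \<open>N\<close>. The trivial representation is the Specht module of the
  one-row partition \<open>[N]\<close>.
\<close>

definition kronecker_coeff :: "nat \<Rightarrow> nat list list \<Rightarrow> nat" where
  "kronecker_coeff N \<mu>s =
     multiplicity_rep N tabloid_action (specht_module [N])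
       diagonal_action (tensor_product (map specht_module \<mu>s))"

definition rect_kronecker_coeff :: "nat \<Rightarrow> nat \<Rightarrow> nat \<Rightarrow> nat" where
  "rect_kronecker_coeff d n k = kronecker_coeff (n * k) (replicate d (replicate n k))"

end

theory Submission
  imports Defs
begin

text \<open>
  By complete reducibility the multiplicity of the trivial representation is the dimension of the
  space of invariants, so one nonzero invariant in the tensor product suffices. Take the
  symmetrization over $S_N$ of a tensor $e_{t_0} \otimes \dots \otimes e_{t_{d-1}}$ of polytabloids.
  A polytabloid evaluated at a word is the product over the columns of the signs of the permutations
  that the word induces there. Pair up the columns of the rectangle, and let \<open>t\<^sub>m\<close> be the tableau
  numbered row by row in which row \<open>r\<close> has the entries of every column pair swapped iff bit \<open>m\<close> of
  \<open>r\<close> is set. Evaluate the symmetrization at \<open>d\<close> equal words. If the product of the $d$ polytabloid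
  values at a word \<open>g\<close> is nonzero, each letter occurs in both columns of a pair, and its two
  occurrences are never in a common column of any \<open>t\<^sub>m\<close>; as rows below $2^{d-1}$ are separated by
  their bits, and bit $d-1$ is never set, the two occurrences share a row. Hence \<open>g\<close> agrees on
  paired columns and each of the $d$ factors is a product of squares. So no term is negative, and
  the term of the identity is 1 at the word recording the row of each entry.
\<close>

section \<open>Multiplicity of the trivial representation\<close>

interpretation cfun_pair: vector_space_pair
  "cscale :: complex \<Rightarrow> ('x \<Rightarrow> complex) \<Rightarrow> 'x \<Rightarrow> complex"
  "cscale :: complex \<Rightarrow> ('y \<Rightarrow> complex) \<Rightarrow> 'y \<Rightarrow> complex"
  by unfold_locales

lemma sum_apply: "(\<Sum>i\<in>A. f i) x = (\<Sum>i\<in>A. f i x)"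
  by (induction A rule: infinite_finite_induct) auto

text \<open>The ambient function space may be infinite dimensional, so the finite set
  \<open>S\<close> supplies finiteness: the basis \<open>C\<close> of \<open>V\<close> extending a
  basis \<open>B\<close> of \<open>U\<close> is finite, and it is strictly larger, since otherwise
  \<open>V\<close> would lie in the span of \<open>B\<close>, hence in \<open>U\<close>.\<close>

lemma dim_strict_mono:
  assumes "cfun.subspace U" "U \<subset> V" "V \<subseteq> cfun.span S" "finite S"
  shows "cfun.dim U < cfun.dim V"
proof -
  obtain B where B: "B \<subseteq> U" "\<not> cfun.dependent B" "U \<subseteq> cfun.span B" "card B = cfun.dim U"
    using cfun.basis_exists by blast
  obtain C where C: "B \<subseteq> C" "C \<subseteq> V" "\<not> cfun.dependent C" "V \<subseteq> cfun.span C"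
    using cfun.maximal_independent_subset_extend[of B V] B assms(2) by blast
  have "finite C"
    using cfun.independent_span_bound[of S C] C assms by blast
  moreover have "cfun.dim V = card C"
    using C cfun.dim_unique by blast
  moreover have "B \<noteq> C"
    using cfun.span_minimal[OF B(1) assms(1)] C(4) assms(2) by blast
  ultimately show ?thesis
    using B(4) C(1) psubset_card_mono[of C B] by auto
qed

section \<open>Internal direct sums\<close>

text \<open>Directness is phrased through the kernel of the sum map, and families are unconstrained
  at indices from \<open>m\<close> on, whereas \<open>irreducible_decomposition\<close> works with
  extensional families.\<close>

definition direct_sum :: "nat \<Rightarrow> (nat \<Rightarrow> ('x \<Rightarrow> complex) set) \<Rightarrow> ('x \<Rightarrow> complex) set \<Rightarrow> bool" where
  "direct_sum m U V \<longleftrightarrow>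
     (\<forall>u. (\<forall>i<m. u i \<in> U i) \<longrightarrow> (\<Sum>i<m. u i) \<in> V) \<and>
     (\<forall>v\<in>V. \<exists>u. (\<forall>i<m. u i \<in> U i) \<and> v = (\<Sum>i<m. u i)) \<and>
     (\<forall>u. (\<forall>i<m. u i \<in> U i) \<and> (\<Sum>i<m. u i) = 0 \<longrightarrow> (\<forall>i<m. u i = 0))"

lemma direct_sum_mem: "direct_sum m U V \<Longrightarrow> (\<And>i. i < m \<Longrightarrow> u i \<in> U i) \<Longrightarrow> (\<Sum>i<m. u i) \<in> V"
  unfolding direct_sum_def by blast

lemma direct_sum_obtain:
  assumes "direct_sum m U V" "v \<in> V"
  obtains u where "\<And>i. i < m \<Longrightarrow> u i \<in> U i" "v = (\<Sum>i<m. u i)"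
  using assms unfolding direct_sum_def by blast

lemma direct_sum_zero:
  "direct_sum m U V \<Longrightarrow> (\<And>i. i < m \<Longrightarrow> u i \<in> U i) \<Longrightarrow> (\<Sum>i<m. u i) = 0 \<Longrightarrow> i < m \<Longrightarrow> u i = 0"
  unfolding direct_sum_def by blast

text \<open>Injectivity of the sum map amounts to a trivial kernel; the subspace hypothesis puts
  differences of families and the zero family back into the \<open>U i\<close>.\<close>

lemma direct_sum_iff_bij_betw:
  assumes sub: "\<And>i. i < m \<Longrightarrow> cfun.subspace (U i)"
  shows "direct_sum m U V \<longleftrightarrow> bij_betw (\<lambda>u. \<Sum>i<m. u i) (\<Pi>\<^sub>E i\<in>{..<m}. U i) V"
    (is "_ \<longleftrightarrow> bij_betw ?s ?P V")
proof
  assume D: "direct_sum m U V"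
  show "bij_betw ?s ?P V"
  proof (rule bij_betw_imageI)
    show "inj_on ?s ?P"
    proof (rule inj_onI)
      fix u u' assume u: "u \<in> ?P" "u' \<in> ?P" and "?s u = ?s u'"
      then have "(\<Sum>i<m. u i - u' i) = 0"
        by (simp add: sum_subtractf)
      moreover have "u i - u' i \<in> U i" if "i < m" for i
        using u that by (intro cfun.subspace_diff sub) (auto simp: PiE_iff)
      ultimately have "u i - u' i = 0" if "i < m" for i
        using direct_sum_zero[OF D, of "\<lambda>i. u i - u' i"] that by blast
      then show "u = u'"
        using u by (intro PiE_ext[of u "{..<m}" U]) (auto simp del: fun_diff_def)
    qed
    show "?s ` ?P = V"
    proof (intro equalityI subsetI)
      fix v assume "v \<in> ?s ` ?P"
      then obtain u where "u \<in> ?P" "v = ?s u" by blast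
      then show "v \<in> V" using direct_sum_mem[OF D, of u] by (simp add: PiE_iff)
    next
      fix v assume "v \<in> V"
      then obtain u where "\<And>i. i < m \<Longrightarrow> u i \<in> U i" "v = ?s u"
        using direct_sum_obtain[OF D] by blast
      then show "v \<in> ?s ` ?P"
        by (intro image_eqI[of _ _ "restrict u {..<m}"]) auto
    qed
  qed
next
  assume B: "bij_betw ?s ?P V"
  \<comment> \<open>Truncation makes a family extensional without changing its sum.\<close>
  have r: "?s (restrict u {..<m}) = ?s u" for u :: "nat \<Rightarrow> 'a \<Rightarrow> complex"
    by (intro sum.cong) auto
  show "direct_sum m U V"
    unfolding direct_sum_def
  proof (intro conjI allI ballI impI)
    fix u :: "nat \<Rightarrow> 'a \<Rightarrow> complex" assume "\<forall>i<m. u i \<in> U i"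
    then have "restrict u {..<m} \<in> ?P" by auto
    then show "?s u \<in> V" using bij_betw_apply[OF B] r by metis
  next
    fix v assume "v \<in> V"
    then obtain u where "u \<in> ?P" "v = ?s u"
      using B by (auto simp: bij_betw_def)
    then show "\<exists>u. (\<forall>i<m. u i \<in> U i) \<and> v = ?s u"
      by (auto simp: PiE_iff)
  next
    fix u i assume u: "(\<forall>i<m. u i \<in> U i) \<and> ?s u = 0" and i: "i < m"
    have "restrict u {..<m} \<in> ?P" "restrict (\<lambda>_. 0) {..<m} \<in> ?P"
      using u sub by (auto simp: cfun.subspace_0)
    moreover have "?s (restrict u {..<m}) = ?s (restrict (\<lambda>_. 0) {..<m})"
      unfolding r using u by simp
    ultimately have "restrict u {..<m} = restrict (\<lambda>_. 0) {..<m}"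
      using B by (auto simp: bij_betw_def inj_on_def)
    then show "u i = 0" using i by (metis lessThan_iff restrict_apply')
  qed
qed

lemma irreducible_decomposition_iff:
  "irreducible_decomposition N \<rho> V m U \<longleftrightarrow>
     (\<forall>i<m. irreducible_rep N \<rho> (U i)) \<and> direct_sum m U V"
proof (cases "\<forall>i<m. irreducible_rep N \<rho> (U i)")
  case True
  then have "direct_sum m U V \<longleftrightarrow> bij_betw (\<lambda>u. \<Sum>i<m. u i) (\<Pi>\<^sub>E i\<in>{..<m}. U i) V"
    by (intro direct_sum_iff_bij_betw) (auto simp: irreducible_rep_def stable_subspace_def)
  then show ?thesis using True by (simp add: irreducible_decomposition_def)
qed (auto simp: irreducible_decomposition_def)

section \<open>Complete reducibility\<close>

text \<open>The group laws are demanded on \<open>V\<close> only: \<open>diagonal_action\<close>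
  need not respect composition at words shorter than \<open>N\<close>, where
  \<open>permute_list\<close> may index past the end.\<close>

definition representation :: "nat \<Rightarrow> 'x action \<Rightarrow> ('x \<Rightarrow> complex) set \<Rightarrow> bool" where
  "representation N \<rho> V \<longleftrightarrow>
     stable_subspace N \<rho> V \<and> (\<exists>S. finite S \<and> V \<subseteq> cfun.span S) \<and>
     (\<forall>p. p permutes {..<N} \<longrightarrow> Vector_Spaces.linear cscale cscale (\<rho> p)) \<and>
     (\<forall>v\<in>V. \<rho> id v = v) \<and>
     (\<forall>p q. \<forall>v\<in>V. p permutes {..<N} \<and> q permutes {..<N} \<longrightarrow> \<rho> (p \<circ> q) v = \<rho> p (\<rho> q v))"

lemma representationD:
  assumes "representation N \<rho> V"
  shows "stable_subspace N \<rho> V" "cfun.subspace V" "\<exists>S. finite S \<and> V \<subseteq> cfun.span S"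
    "p permutes {..<N} \<Longrightarrow> Vector_Spaces.linear cscale cscale (\<rho> p)"
    "v \<in> V \<Longrightarrow> \<rho> id v = v"
    "v \<in> V \<Longrightarrow> p permutes {..<N} \<Longrightarrow> q permutes {..<N} \<Longrightarrow> \<rho> (p \<circ> q) v = \<rho> p (\<rho> q v)"
  using assms by (simp_all add: representation_def stable_subspace_def)

lemma representation_subspace:
  assumes V: "representation N \<rho> V" and U: "stable_subspace N \<rho> U" "U \<subseteq> V"
  shows "representation N \<rho> U"
proof -
  obtain S where S: "finite S" "V \<subseteq> cfun.span S"
    using representationD(3)[OF V] by metis
  have "U \<subseteq> cfun.span S" using S(2) U(2) by (rule order_trans[rotated])
  then show ?thesis
    unfolding representation_def
    using S(1) U(1) representationD(4-6)[OF V] subsetD[OF U(2)]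
    by (intro conjI exI[of _ S] allI ballI impI) simp_all
qed

text \<open>Maschke's theorem: averaging a linear projection onto \<open>U\<close> over the group
  gives an equivariant projection \<open>P\<close>, and the complement is the kernel of
  \<open>P\<close> inside \<open>V\<close>.\<close>

lemma stable_complement:
  assumes V: "representation N \<rho> V" and U: "stable_subspace N \<rho> U" "U \<subseteq> V"
  obtains V' where "stable_subspace N \<rho> V'" "V' \<subseteq> V" "U \<inter> V' = {0}"
    "\<And>v. v \<in> V \<Longrightarrow> \<exists>u\<in>U. v - u \<in> V'"
proof -
  define G where "G = {p. p permutes {..<N}}"
  have cardG: "card G = fact N"
    unfolding G_def using card_permutations[of "{..<N}" N] by simp
  have lin: "Vector_Spaces.linear cscale cscale (\<rho> p)" if "p \<in> G" for p
    using representationD(4)[OF V] that by (simp add: G_def)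
  have hom: "\<rho> p (\<rho> q v) = \<rho> (p \<circ> q) v" if "p \<in> G" "q \<in> G" "v \<in> V" for p q v
    using representationD(6)[OF V] that by (simp add: G_def)
  note one = representationD(5)[OF V]
  note subV = representationD(2)[OF V]
  have subU: "cfun.subspace U"
    using U by (simp add: stable_subspace_def)
  have stV: "\<rho> p v \<in> V" if "p \<in> G" "v \<in> V" for p v
    using representationD(1)[OF V] that unfolding stable_subspace_def G_def by blast
  have stU: "\<rho> p v \<in> U" if "p \<in> G" "v \<in> U" for p v
    using U that unfolding stable_subspace_def G_def by blast
  have inG: "inv p \<in> G" if "p \<in> G" for p
    using that by (auto simp: G_def permutes_inv)
  have compG: "p \<circ> q \<in> G" if "p \<in> G" "q \<in> G" for p q
    using that by (auto simp: G_def permutes_compose)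
  have inv_l: "inv p \<circ> p = id" and inv_r: "p \<circ> inv p = id" if "p \<in> G" for p
    using that by (auto simp: G_def permutes_inv_o)
  obtain B where B: "B \<subseteq> U" "\<not> cfun.dependent B" "U \<subseteq> cfun.span B"
    using cfun.basis_exists[of U] by metis
  \<comment> \<open>A projection of the whole function space onto \<open>U\<close>: it fixes a basis
    of \<open>U\<close> and takes values in the span of that basis.\<close>
  define \<pi> where "\<pi> = cfun_pair.construct B id"
  have lin\<pi>: "Vector_Spaces.linear cscale cscale \<pi>"
    unfolding \<pi>_def by (rule cfun_pair.linear_construct[OF B(2)])
  have \<pi>U: "\<pi> v \<in> U" for v
    using cfun_pair.construct_in_span[OF B(2), of id v] cfun.span_minimal[OF B(1) subU]
    unfolding \<pi>_def by auto
  have \<pi>_id: "\<pi> u = u" if "u \<in> U" for u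
  proof -
    have "\<pi> b = id b" if "b \<in> B" for b
      unfolding \<pi>_def by (rule cfun_pair.construct_basis[OF B(2) that])
    then show ?thesis
      using cfun_pair.linear_eq_on[OF lin\<pi> cfun.linear_id, of u B] that B(3) by auto
  qed
  define P where "P v = cscale (1 / fact N) (\<Sum>p\<in>G. \<rho> p (\<pi> (\<rho> (inv p) v)))" for v
  have linP: "Vector_Spaces.linear cscale cscale P"
    unfolding P_def
  proof (intro cfun_pair.linear_compose_scale_right cfun_pair.linear_compose_sum ballI)
    fix p assume p: "p \<in> G"
    have "Vector_Spaces.linear cscale cscale (\<rho> p \<circ> (\<pi> \<circ> \<rho> (inv p)))"
      using Vector_Spaces.linear_compose[OF Vector_Spaces.linear_compose[OF lin[OF inG[OF p]] lin\<pi>] lin[OF p]]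
      by (simp add: o_assoc)
    then show "Vector_Spaces.linear cscale cscale (\<lambda>v. \<rho> p (\<pi> (\<rho> (inv p) v)))"
      by (simp add: o_def)
  qed
  have PU: "P v \<in> U" for v
    unfolding P_def using subU \<pi>U stU by (intro cfun.subspace_scale cfun.subspace_sum) auto
  have P_id: "P u = u" if "u \<in> U" for u
  proof -
    have "\<rho> p (\<pi> (\<rho> (inv p) u)) = u" if "p \<in> G" for p
      using \<open>u \<in> U\<close> U(2) that by (simp add: \<pi>_id stU inG hom subsetD inv_r one)
    then have "P u = cscale (1 / fact N) (\<Sum>p\<in>G. u)"
      unfolding P_def by (metis (no_types, lifting) sum.cong)
    also have "\<dots> = u"
    proof
      fix x
      have "(\<Sum>p\<in>G. u) x = fact N * u x"
        by (subst sum_apply) (simp add: cardG)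
      then show "cscale (1 / fact N) (\<Sum>p\<in>G. u) x = u x"
        by (simp add: cscale_def del: sum_constant)
    qed
    finally show ?thesis .
  qed
  have P_comm: "P (\<rho> q v) = \<rho> q (P v)" if q: "q \<in> G" and v: "v \<in> V" for q v
  proof -
    \<comment> \<open>Replacing the summation variable \<open>p\<close> by
      \<open>q \<circ> p\<close> cancels the \<open>q\<close> acting on \<open>v\<close> and leaves
      it on the outside.\<close>
    have "(\<Sum>p\<in>G. \<rho> p (\<pi> (\<rho> (inv p) (\<rho> q v)))) = (\<Sum>p\<in>G. \<rho> (q \<circ> p) (\<pi> (\<rho> (inv p) v)))"
    proof (rule sum.reindex_bij_witness[of _ "\<lambda>p. q \<circ> p" "\<lambda>p. inv q \<circ> p"])
      fix p assume p: "p \<in> G"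
      have "inv (inv q \<circ> p) = inv p \<circ> q"
        using p q unfolding G_def
        by (metis mem_Collect_eq o_inv_distrib permutes_bij permutes_inv permutes_inv_inv)
      then show "\<rho> (q \<circ> (inv q \<circ> p)) (\<pi> (\<rho> (inv (inv q \<circ> p)) v)) = \<rho> p (\<pi> (\<rho> (inv p) (\<rho> q v)))"
        using p q v by (simp add: hom inG o_assoc inv_r)
    qed (use q in \<open>auto simp: compG inG o_assoc inv_l inv_r\<close>)
    also have "\<dots> = (\<Sum>p\<in>G. \<rho> q (\<rho> p (\<pi> (\<rho> (inv p) v))))"
      using q \<pi>U U(2) by (intro sum.cong refl hom[symmetric]) auto
    also have "\<dots> = \<rho> q (\<Sum>p\<in>G. \<rho> p (\<pi> (\<rho> (inv p) v)))"
      by (simp add: cfun_pair.linear_sum[OF lin[OF q]])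
    finally show ?thesis
      unfolding P_def by (simp add: cfun_pair.linear_scale[OF lin[OF q]])
  qed
  define V' where "V' = {v \<in> V. P v = 0}"
  have "cfun.subspace V'"
    unfolding V'_def cfun.subspace_def
    using subV cfun_pair.linear_add[OF linP] cfun_pair.linear_scale[OF linP]
      cfun_pair.linear_0[OF linP]
    by (auto simp: cfun.subspace_0 cfun.subspace_add cfun.subspace_scale)
  then have "stable_subspace N \<rho> V'"
    unfolding stable_subspace_def V'_def
    using P_comm stV cfun_pair.linear_0[OF lin] by (auto simp: G_def)
  moreover have "U \<inter> V' = {0}"
    using P_id subU subV cfun_pair.linear_0[OF linP] U(2)
    by (auto simp: V'_def cfun.subspace_0)
  moreover have "v - P v \<in> V'" if "v \<in> V" for v
    using that PU[of v] U(2) cfun_pair.linear_diff[OF linP] P_id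
    by (auto simp: V'_def intro!: cfun.subspace_diff subV)
  ultimately show ?thesis
    using that[of V'] PU by (auto simp: V'_def)
qed

text \<open>A nonzero stable subspace of least dimension works, because a proper nonzero stable
  subspace of it would have smaller dimension.\<close>

lemma exists_irreducible_subrep:
  assumes V: "representation N \<rho> V" and "V \<noteq> {0}"
  obtains U where "irreducible_rep N \<rho> U" "U \<subseteq> V"
proof -
  let ?Q = "\<lambda>U. stable_subspace N \<rho> U \<and> U \<subseteq> V \<and> U \<noteq> {0}"
  have "?Q V" using assms by (auto simp: representation_def)
  then obtain U where U: "?Q U" and min: "\<And>U'. ?Q U' \<Longrightarrow> cfun.dim U \<le> cfun.dim U'"
    using ex_has_least_nat[of ?Q V cfun.dim] by blast
  obtain S where S: "finite S" "V \<subseteq> cfun.span S"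
    using V by (auto simp: representation_def)
  have "U' = {0} \<or> U' = U" if "stable_subspace N \<rho> U'" "U' \<subseteq> U" for U'
  proof (rule ccontr)
    assume *: "\<not> (U' = {0} \<or> U' = U)"
    then have "cfun.dim U' < cfun.dim U"
      using that U S by (intro dim_strict_mono[of _ _ S]) (auto simp: stable_subspace_def)
    then show False using min[of U'] that U * by auto
  qed
  then have "irreducible_rep N \<rho> U" using U unfolding irreducible_rep_def by blast
  then show ?thesis using that U by blast
qed

text \<open>Induction on the dimension: an irreducible \<open>W\<close> is split off, and its stable
  complement is strictly smaller because \<open>W\<close> is nonzero.\<close>

lemma exists_irreducible_decomposition:
  assumes "representation N \<rho> V"
  shows "\<exists>m U. irreducible_decomposition N \<rho> V m U"
  using assms
proof (induction "cfun.dim V" arbitrary: V rule: less_induct)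
  case less
  show ?case
  proof (cases "V = {0}")
    case True
    then have "irreducible_decomposition N \<rho> V 0 (\<lambda>_. {})"
      by (simp add: irreducible_decomposition_iff direct_sum_def)
    then show ?thesis by blast
  next
    case False
    obtain W where W: "irreducible_rep N \<rho> W" "W \<subseteq> V"
      using exists_irreducible_subrep[OF less.prems False] .
    obtain V' where V': "stable_subspace N \<rho> V'" "V' \<subseteq> V" "W \<inter> V' = {0}"
      "\<And>v. v \<in> V \<Longrightarrow> \<exists>u\<in>W. v - u \<in> V'"
      using stable_complement[OF less.prems, of W] W unfolding irreducible_rep_def by metis
    have sub: "cfun.subspace V'" "cfun.subspace W" "cfun.subspace V" and "W \<noteq> {0}"
      using V' W less.prems
      by (auto simp: stable_subspace_def irreducible_rep_def representation_def)
    obtain S where S: "finite S" "V \<subseteq> cfun.span S"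
      using less.prems by (auto simp: representation_def)
    have "V' \<noteq> V" using V'(3) W(2) \<open>W \<noteq> {0}\<close> by blast
    then have "cfun.dim V' < cfun.dim V"
      using V' sub S by (intro dim_strict_mono[of _ _ S]) auto
    then obtain m U where U: "irreducible_decomposition N \<rho> V' m U"
      using less.hyps representation_subspace[OF less.prems V'(1,2)] by blast
    then have ds: "direct_sum m U V'" by (simp add: irreducible_decomposition_iff)
    \<comment> \<open>\<open>W\<close> becomes the last summand, so that a sum over
      \<open>Suc m\<close> indices splits into a part in \<open>V'\<close> and a part in
      \<open>W\<close>.\<close>
    define U' where "U' = U(m := W)"
    have "direct_sum (Suc m) U' V"
      unfolding direct_sum_def
    proof (intro conjI allI ballI impI)
      fix u assume u': "\<forall>i<Suc m. u i \<in> U' i"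
      then have u: "u i \<in> U' i" if "i < Suc m" for i using that by blast
      have "u i \<in> U i" if "i < m" for i
        using u[of i] that by (simp add: U'_def)
      then have "(\<Sum>i<m. u i) \<in> V'"
        by (rule direct_sum_mem[OF ds])
      moreover have "u m \<in> W" using u[of m] by (simp add: U'_def)
      ultimately show "(\<Sum>i<Suc m. u i) \<in> V"
        using V'(2) W(2) sub by (auto intro!: cfun.subspace_add)
    next
      fix v assume "v \<in> V"
      then obtain w where w: "w \<in> W" "v - w \<in> V'" using V'(4) by blast
      obtain u where u: "\<And>i. i < m \<Longrightarrow> u i \<in> U i" "v - w = (\<Sum>i<m. u i)"
        using direct_sum_obtain[OF ds w(2)] by blast
      have "(\<Sum>i<m. (u(m := w)) i) = (\<Sum>i<m. u i)" by (intro sum.cong) auto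
      then show "\<exists>u. (\<forall>i<Suc m. u i \<in> U' i) \<and> v = (\<Sum>i<Suc m. u i)"
        using u w by (intro exI[of _ "u(m := w)"]) (auto simp: U'_def less_Suc_eq algebra_simps)
    next
      fix u i assume u: "(\<forall>i<Suc m. u i \<in> U' i) \<and> (\<Sum>i<Suc m. u i) = 0" and i: "i < Suc m"
      have um: "u m \<in> W"
        using u[THEN conjunct1, rule_format, of m] by (simp add: U'_def)
      have ui: "u i \<in> U i" if "i < m" for i
        using u[THEN conjunct1, rule_format, of i] that by (simp add: U'_def)
      have "(\<Sum>i<m. u i) \<in> V'"
        by (intro direct_sum_mem[OF ds] ui)
      \<comment> \<open>The last component lies in \<open>W\<close> and, as the negative of the
        others' sum, also in \<open>V'\<close>; hence it vanishes.\<close>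
      moreover have "u m = - (\<Sum>i<m. u i)"
        using u[THEN conjunct2] unfolding sum.lessThan_Suc by (metis minus_unique)
      ultimately have "u m \<in> V'" using sub(1) cfun.subspace_neg by metis
      then have 0: "u m = 0" using um V'(3) by blast
      then have "(\<Sum>i<m. u i) = 0" using u by simp
      then have "\<forall>i<m. u i = 0"
        using direct_sum_zero[OF ds ui] by blast
      then show "u i = 0" using 0 i by (auto simp: less_Suc_eq)
    qed
    moreover have "\<forall>i<Suc m. irreducible_rep N \<rho> (U' i)"
      using U W by (auto simp: U'_def less_Suc_eq irreducible_decomposition_iff)
    ultimately have "irreducible_decomposition N \<rho> V (Suc m) U'"
      by (simp add: irreducible_decomposition_iff)
    then show ?thesis by blast
  qed
qed

section \<open>Invariant vectors and trivial summands\<close>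

definition invariants :: "nat \<Rightarrow> 'x action \<Rightarrow> ('x \<Rightarrow> complex) set \<Rightarrow> ('x \<Rightarrow> complex) set" where
  "invariants N \<rho> V = {v \<in> V. \<forall>p. p permutes {..<N} \<longrightarrow> \<rho> p v = v}"

text \<open>The line through a nonzero invariant vector is stable, so irreducibility leaves no room
  beside it.\<close>

lemma irreducible_span_invariant:
  assumes U: "irreducible_rep N \<rho> U"
    and lin: "\<And>p. p permutes {..<N} \<Longrightarrow> Vector_Spaces.linear cscale cscale (\<rho> p)"
    and u: "u \<in> invariants N \<rho> U" "u \<noteq> 0"
  shows "U = cfun.span {u}"
proof -
  have "\<rho> p x = x" if "p permutes {..<N}" "x \<in> cfun.span {u}" for p x
    using that u by (auto simp: cfun.span_singleton invariants_def cfun_pair.linear_scale[OF lin])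
  then have "stable_subspace N \<rho> (cfun.span {u})"
    unfolding stable_subspace_def by (auto simp: cfun.subspace_span)
  moreover have "cfun.span {u} \<subseteq> U"
    using U u by (intro cfun.span_minimal)
      (auto simp: irreducible_rep_def stable_subspace_def invariants_def)
  moreover have "cfun.span {u} \<noteq> {0}"
    using u cfun.span_base[of u "{u}"] by auto
  ultimately show ?thesis
    using U unfolding irreducible_rep_def by blast
qed

text \<open>The line spanned by the fixed vector \<open>w\<close> is the trivial representation. An
  isomorphism pulls its trivial action back to all of \<open>U\<close>; conversely \<open>U\<close>
  is the line through an invariant vector, and sending that vector to \<open>w\<close> is
  equivariant.\<close>

lemma isomorphic_trivial_iff:
  assumes U: "irreducible_rep N \<rho> U"
    and lin: "\<And>p. p permutes {..<N} \<Longrightarrow> Vector_Spaces.linear cscale cscale (\<rho> p)"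
    and linW: "\<And>p. p permutes {..<N} \<Longrightarrow> Vector_Spaces.linear cscale cscale (\<sigma> p)"
    and w: "w \<noteq> 0" "\<And>p. p permutes {..<N} \<Longrightarrow> \<sigma> p w = w"
  shows "isomorphic_rep N \<rho> U \<sigma> (cfun.span {w}) \<longleftrightarrow> (\<exists>u\<in>invariants N \<rho> U. u \<noteq> 0)"
proof
  have triv: "\<sigma> p x = x" if "p permutes {..<N}" "x \<in> cfun.span {w}" for p x
    using that w by (auto simp: cfun.span_singleton cfun_pair.linear_scale[OF linW])
  {
    assume "isomorphic_rep N \<rho> U \<sigma> (cfun.span {w})"
    then obtain \<phi> where \<phi>: "bij_betw \<phi> U (cfun.span {w})"
      "\<And>p u. p permutes {..<N} \<Longrightarrow> u \<in> U \<Longrightarrow> \<phi> (\<rho> p u) = \<sigma> p (\<phi> u)"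
      unfolding isomorphic_rep_def by blast
    have "\<rho> p u = u" if "p permutes {..<N}" "u \<in> U" for p u
    proof -
      have "\<phi> (\<rho> p u) = \<phi> u"
        using that \<phi> triv bij_betw_apply by metis
      \<comment> \<open>Membership matters because \<open>\<phi>\<close> is injective on
        \<open>U\<close> only.\<close>
      moreover have "\<rho> p u \<in> U"
        using U that unfolding irreducible_rep_def stable_subspace_def by blast
      ultimately show ?thesis
        using \<phi>(1) that by (auto simp: bij_betw_def inj_on_def)
    qed
    moreover obtain u where "u \<in> U" "u \<noteq> 0"
      using U cfun.subspace_0[of U] unfolding irreducible_rep_def stable_subspace_def by blast
    ultimately show "\<exists>u\<in>invariants N \<rho> U. u \<noteq> 0"
      by (auto simp: invariants_def)
  next
    assume "\<exists>u\<in>invariants N \<rho> U. u \<noteq> 0"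
    then obtain u where u: "u \<in> invariants N \<rho> U" "u \<noteq> 0" by blast
    have Uu: "U = cfun.span {u}"
      by (rule irreducible_span_invariant[OF U lin u])
    have ind: "\<not> cfun.dependent {u}" using u by simp
    define \<phi> where "\<phi> = cfun_pair.construct {u} (\<lambda>_. w)"
    have lin\<phi>: "Vector_Spaces.linear cscale cscale \<phi>"
      unfolding \<phi>_def by (rule cfun_pair.linear_construct[OF ind])
    have "\<phi> u = w"
      unfolding \<phi>_def using cfun_pair.construct_basis[OF ind] by blast
    then have \<phi>: "\<phi> (cscale c u) = cscale c w" for c
      by (simp add: cfun_pair.linear_scale[OF lin\<phi>])
    have "bij_betw \<phi> U (cfun.span {w})"
      unfolding bij_betw_def Uu cfun.span_singleton
      using w u by (auto simp: inj_on_def \<phi> image_iff)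
    moreover have "\<phi> (\<rho> p x) = \<sigma> p (\<phi> x)" if "p permutes {..<N}" "x \<in> U" for p x
    proof -
      have "x \<in> range (\<lambda>c. cscale c u)"
        using \<open>x \<in> U\<close> Uu by (simp add: cfun.span_singleton)
      then obtain c where x: "x = cscale c u" by blast
      have "\<rho> p x = x"
        using u that by (simp add: x cfun_pair.linear_scale[OF lin] invariants_def)
      moreover have "\<phi> x \<in> cfun.span {w}" by (auto simp: x \<phi> cfun.span_singleton)
      ultimately show ?thesis using triv that by simp
    qed
    ultimately show "isomorphic_rep N \<rho> U \<sigma> (cfun.span {w})"
      unfolding isomorphic_rep_def using lin\<phi> by blast
  }
qed

text \<open>Each summand with a nonzero invariant is a line; generators \<open>b i\<close> of these
  lines form a basis of the invariants of \<open>V\<close>.\<close>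

lemma card_trivial_summands:
  assumes V: "representation N \<rho> V" and D: "irreducible_decomposition N \<rho> V m U"
  shows "card {i. i < m \<and> (\<exists>u\<in>invariants N \<rho> (U i). u \<noteq> 0)} = cfun.dim (invariants N \<rho> V)"
proof -
  define I where "I = {i. i < m \<and> (\<exists>u\<in>invariants N \<rho> (U i). u \<noteq> 0)}"
  have lin: "Vector_Spaces.linear cscale cscale (\<rho> p)" if "p permutes {..<N}" for p
    using V that by (auto simp: representation_def)
  have irr: "irreducible_rep N \<rho> (U i)" if "i < m" for i
    using D that by (auto simp: irreducible_decomposition_iff)
  have ds: "direct_sum m U V" using D by (simp add: irreducible_decomposition_iff)
  have sub: "cfun.subspace (U i)" if "i < m" for i
    using irr that by (auto simp: irreducible_rep_def stable_subspace_def)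
  have "\<forall>i\<in>I. \<exists>u. u \<in> invariants N \<rho> (U i) \<and> u \<noteq> 0" by (auto simp: I_def)
  then obtain b where b: "\<And>i. i \<in> I \<Longrightarrow> b i \<in> invariants N \<rho> (U i)" "\<And>i. i \<in> I \<Longrightarrow> b i \<noteq> 0"
    by metis
  have bU: "U i = cfun.span {b i}" if "i \<in> I" for i
    using irreducible_span_invariant[OF irr lin b(1)[OF that] b(2)[OF that]] that
    by (auto simp: I_def)
  have bi: "b i \<in> U i" if "i \<in> I" for i using b(1)[OF that] by (simp add: invariants_def)
  have finI: "finite I" and Im: "I \<subseteq> {..<m}" by (auto simp: I_def)
  have zero: "c i = 0" if "(\<Sum>i\<in>I. cscale (c i) (b i)) = 0" "i \<in> I" for c i
  proof -
    \<comment> \<open>Extending the relation by zero to all \<open>m\<close> summands makes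
      directness of the sum applicable.\<close>
    define u where "u i = (if i \<in> I then cscale (c i) (b i) else 0)" for i
    have "(\<Sum>i<m. u i) = (\<Sum>i\<in>I. cscale (c i) (b i))"
      unfolding u_def using Im finI by (simp add: sum.If_cases Int_absorb1)
    moreover have "\<forall>i<m. u i \<in> U i"
      using sub bi by (auto simp: u_def cfun.subspace_0 cfun.subspace_scale)
    ultimately have "u i = 0"
      using direct_sum_zero[OF ds, of u i] that Im by auto
    then show ?thesis using that b(2) by (simp add: u_def)
  qed
  have inj: "inj_on b I"
  proof (rule inj_onI, rule ccontr)
    fix i j assume ij: "i \<in> I" "j \<in> I" "b i = b j" "i \<noteq> j"
    \<comment> \<open>A generator shared by two summands would give the nontrivial relation with
      coefficients 1 and -1.\<close>
    have "(\<Sum>l\<in>I. cscale (if l = i then 1 else if l = j then -1 else 0) (b l)) =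
          (\<Sum>l\<in>{i,j}. cscale (if l = i then 1 else if l = j then -1 else 0) (b l))"
      using ij finI by (intro sum.mono_neutral_right) auto
    also have "\<dots> = 0" using ij by simp
    finally show False using zero[of "\<lambda>l. if l = i then 1 else if l = j then -1 else 0" i] ij by auto
  qed
  have indep: "\<not> cfun.dependent (b ` I)"
  proof
    assume "cfun.dependent (b ` I)"
    then obtain c where c: "\<exists>v\<in>b ` I. c v \<noteq> 0" "(\<Sum>v\<in>b ` I. cscale (c v) v) = 0"
      using cfun.dependent_finite[of "b ` I"] finI by auto
    then have "(\<Sum>i\<in>I. cscale (c (b i)) (b i)) = 0"
      using inj by (simp add: sum.reindex)
    then show False using zero[of "\<lambda>i. c (b i)"] c(1) by auto
  qed
  have "b ` I \<subseteq> invariants N \<rho> V"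
  proof safe
    fix i assume i: "i \<in> I"
    have "(\<Sum>j<m. if j = i then b i else 0) \<in> V"
      using sub i bi by (intro direct_sum_mem[OF ds]) (auto simp: cfun.subspace_0)
    then have "b i \<in> V" using i Im by (auto simp: sum.delta)
    then show "b i \<in> invariants N \<rho> V" using b(1)[OF i] by (auto simp: invariants_def)
  qed
  moreover have "invariants N \<rho> V \<subseteq> cfun.span (b ` I)"
  proof
    fix v assume v: "v \<in> invariants N \<rho> V"
    then obtain u where u: "\<And>i. i < m \<Longrightarrow> u i \<in> U i" "v = (\<Sum>i<m. u i)"
      using direct_sum_obtain[OF ds, of v] unfolding invariants_def by blast
    have inv: "u i \<in> invariants N \<rho> (U i)" if "i < m" for i
      unfolding invariants_def
    proof (intro CollectI conjI allI impI)
      show "u i \<in> U i" using u that by blast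
      fix p assume p: "p permutes {..<N}"
      \<comment> \<open>The components of an invariant vector are invariant:
        \<open>\<rho> p v - v = 0\<close> splits along the direct sum. Components outside
        \<open>I\<close> then vanish.\<close>
      have "(\<Sum>i<m. \<rho> p (u i) - u i) = \<rho> p v - v"
        by (simp add: u(2) sum_subtractf cfun_pair.linear_sum[OF lin[OF p]])
      also have "\<dots> = 0" using v p by (simp add: invariants_def)
      finally have s: "(\<Sum>i<m. \<rho> p (u i) - u i) = 0" .
      have "\<rho> p (u i) - u i \<in> U i" if "i < m" for i
        using irr[OF that] p u(1)[OF that] unfolding irreducible_rep_def stable_subspace_def
        by (intro cfun.subspace_diff) blast+
      from direct_sum_zero[OF ds this s that] show "\<rho> p (u i) = u i" by simp
    qed
    have "u i \<in> cfun.span (b ` I)" if "i < m" for i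
    proof (cases "u i = 0")
      case False
      then have "i \<in> I" using inv that by (auto simp: I_def)
      then show ?thesis
        using u that bU[of i] cfun.span_mono[of "{b i}" "b ` I"] by auto
    qed (simp add: cfun.span_zero)
    then show "v \<in> cfun.span (b ` I)"
      unfolding u(2) by (intro cfun.span_sum) auto
  qed
  ultimately have "cfun.dim (invariants N \<rho> V) = card (b ` I)"
    using indep by (intro cfun.dim_unique[of "b ` I"]) auto
  then show ?thesis using inj by (simp add: card_image I_def)
qed

text \<open>Every decomposition yields the same count, namely the dimension of the invariants, and
  complete reducibility provides a decomposition; so the description by \<open>THE\<close> denotes
  this number.\<close>

theorem multiplicity_trivial:
  assumes V: "representation N \<rho> V"
    and linW: "\<And>p. p permutes {..<N} \<Longrightarrow> Vector_Spaces.linear cscale cscale (\<sigma> p)"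
    and w: "w \<noteq> 0" "\<And>p. p permutes {..<N} \<Longrightarrow> \<sigma> p w = w"
  shows "multiplicity_rep N \<sigma> (cfun.span {w}) \<rho> V = cfun.dim (invariants N \<rho> V)"
proof -
  have lin: "Vector_Spaces.linear cscale cscale (\<rho> p)" if "p permutes {..<N}" for p
    using V that by (auto simp: representation_def)
  have *: "card {i. i < m \<and> isomorphic_rep N \<rho> (U i) \<sigma> (cfun.span {w})} =
           cfun.dim (invariants N \<rho> V)"
    if D: "irreducible_decomposition N \<rho> V m U" for m U
  proof -
    have "isomorphic_rep N \<rho> (U i) \<sigma> (cfun.span {w}) \<longleftrightarrow> (\<exists>u\<in>invariants N \<rho> (U i). u \<noteq> 0)"
      if "i < m" for i
      using D that by (intro isomorphic_trivial_iff lin linW w)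
        (auto simp: irreducible_decomposition_iff)
    then have "{i. i < m \<and> isomorphic_rep N \<rho> (U i) \<sigma> (cfun.span {w})} =
               {i. i < m \<and> (\<exists>u\<in>invariants N \<rho> (U i). u \<noteq> 0)}"
      by blast
    then show ?thesis
      using card_trivial_summands[OF V D] by simp
  qed
  show ?thesis
    unfolding multiplicity_rep_def
  proof (rule the_equality)
    obtain m U where D: "irreducible_decomposition N \<rho> V m U"
      using exists_irreducible_decomposition[OF V] by blast
    show "\<exists>m U. irreducible_decomposition N \<rho> V m U \<and> cfun.dim (invariants N \<rho> V) =
            card {i. i < m \<and> isomorphic_rep N \<rho> (U i) \<sigma> (cfun.span {w})}"
      by (intro exI conjI) (rule D, rule *[OF D, symmetric])
  qed (use * in blast)
qed

text \<open>Finite dimensionality is essential here, since \<open>cfun.dim\<close> is 0 on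
  infinite-dimensional spaces.\<close>

lemma multiplicity_trivial_pos:
  assumes V: "representation N \<rho> V"
    and linW: "\<And>p. p permutes {..<N} \<Longrightarrow> Vector_Spaces.linear cscale cscale (\<sigma> p)"
    and w: "w \<noteq> 0" "\<And>p. p permutes {..<N} \<Longrightarrow> \<sigma> p w = w"
    and v: "v \<in> invariants N \<rho> V" "v \<noteq> 0"
  shows "multiplicity_rep N \<sigma> (cfun.span {w}) \<rho> V > 0"
proof -
  obtain S where S: "finite S" "V \<subseteq> cfun.span S"
    using V by (auto simp: representation_def)
  have "cfun.dim {0 :: 'a \<Rightarrow> complex} < cfun.dim (invariants N \<rho> V)"
  proof (rule dim_strict_mono[OF cfun.subspace_single_0 _ _ S(1)])
    have "0 \<in> invariants N \<rho> V"
      using V unfolding representation_def invariants_def stable_subspace_def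
      by (auto simp: cfun.subspace_0 cfun_pair.linear_0)
    then show "{0} \<subset> invariants N \<rho> V" using v by auto
    show "invariants N \<rho> V \<subseteq> cfun.span S" using S by (auto simp: invariants_def)
  qed
  then show ?thesis using multiplicity_trivial[OF V linW w] by simp
qed

section \<open>Polytabloids of rectangular shape\<close>

text \<open>The Levi-Civita symbol of \<open>w 0, ..., w (n - 1)\<close>: at most one summand is
  nonzero.\<close>

definition sgn_word :: "nat \<Rightarrow> (nat \<Rightarrow> nat) \<Rightarrow> int" where
  "sgn_word n w = (\<Sum>\<sigma> | \<sigma> permutes {..<n}. if \<forall>i<n. w i = \<sigma> i then sign \<sigma> else 0)"

lemma sgn_word_cong:
  assumes "\<And>i. i < n \<Longrightarrow> w i = w' i"
  shows "sgn_word n w = sgn_word n w'"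
  using assms unfolding sgn_word_def by (intro sum.cong refl) auto

lemma sgn_word_permutes:
  assumes \<sigma>: "\<sigma> permutes {..<n}" and w: "\<And>i. i < n \<Longrightarrow> w i = \<sigma> i"
  shows "sgn_word n w = sign \<sigma>"
proof -
  have "(\<forall>i<n. w i = \<tau> i) \<longleftrightarrow> \<tau> = \<sigma>" if "\<tau> permutes {..<n}" for \<tau>
  proof
    assume *: "\<forall>i<n. w i = \<tau> i"
    show "\<tau> = \<sigma>"
    proof
      fix i show "\<tau> i = \<sigma> i"
        using * w[of i] permutes_not_in[OF \<sigma>, of i] permutes_not_in[OF that, of i]
        by (cases "i < n") auto
    qed
  qed (use w in auto)
  then have "sgn_word n w = (\<Sum>\<tau> | \<tau> permutes {..<n}. if \<tau> = \<sigma> then sign \<tau> else 0)"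
    unfolding sgn_word_def by (intro sum.cong refl) simp
  also have "\<dots> = sign \<sigma>"
    using \<sigma> by (simp add: sum.delta finite_permutations)
  finally show ?thesis .
qed

lemma sgn_word_nonzeroE:
  assumes "sgn_word n w \<noteq> 0"
  obtains \<sigma> where "\<sigma> permutes {..<n}" "\<And>i. i < n \<Longrightarrow> w i = \<sigma> i"
proof -
  obtain \<sigma> where "\<sigma> \<in> {\<sigma>. \<sigma> permutes {..<n}}" "(if \<forall>i<n. w i = \<sigma> i then sign \<sigma> else 0) \<noteq> 0"
    using assms unfolding sgn_word_def by (rule sum.not_neutral_contains_not_neutral)
  then show ?thesis using that by (auto split: if_splits)
qed

lemma sgn_word_transpose:
  assumes ab: "a < n" "b < n" "a \<noteq> b"
  shows "sgn_word n (\<lambda>i. w (transpose a b i)) = - sgn_word n w"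
proof -
  have *: "sgn_word n (\<lambda>i. w (transpose a b i)) = - sgn_word n w" if nz: "sgn_word n w \<noteq> 0" for w
  proof -
    obtain \<sigma> where \<sigma>: "\<sigma> permutes {..<n}" "\<And>i. i < n \<Longrightarrow> w i = \<sigma> i"
      using sgn_word_nonzeroE[OF nz] by blast
    have t: "transpose a b permutes {..<n}"
      using ab by (intro permutes_swap_id) auto
    have "sgn_word n (\<lambda>i. w (transpose a b i)) = sign (\<sigma> \<circ> transpose a b)"
      using \<sigma> t permutes_in_image[OF t]
      by (intro sgn_word_permutes permutes_compose) auto
    also have "\<dots> = - sign \<sigma>"
      using ab \<sigma>(1) by (subst sign_compose)
        (auto simp: sign_swap_id permutation_swap_id intro: permutation_permutes[THEN iffD2])
    finally show ?thesis using sgn_word_permutes[of \<sigma> n w] \<sigma> by simp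
  qed
  \<comment> \<open>If the symbol of \<open>w\<close> vanishes, applying the nonzero case to the
    transposed word and transposing back excludes a nonzero value there.\<close>
  show ?thesis
    using *[of w] *[of "\<lambda>i. w (transpose a b i)"] by (cases "sgn_word n w = 0") auto
qed

text \<open>A permutation preserving the colouring \<open>c\<close> is a product of transpositions
  within colour classes. If \<open>p\<close> moves \<open>a\<close>, then \<open>b = inv p a\<close>
  has the colour of \<open>a\<close>, and \<open>p \<circ> transpose a b\<close> fixes
  \<open>a\<close> while moving no new point.\<close>

lemma permutes_fibres_induct [consumes 3, case_names id transpose]:
  assumes "p permutes S" "finite S" "\<And>x. c (p x) = c x"
    and id: "P id"
    and step: "\<And>a b p. a \<in> S \<Longrightarrow> b \<in> S \<Longrightarrow> a \<noteq> b \<Longrightarrow> c a = c b \<Longrightarrow> p permutes S \<Longrightarrow> P p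
      \<Longrightarrow> P (p \<circ> transpose a b)"
  shows "P p"
  using assms(1,3)
proof (induction "card {x. p x \<noteq> x}" arbitrary: p rule: less_induct)
  case less
  show ?case
  proof (cases "p = id")
    case True
    then show ?thesis using id by simp
  next
    case False
    then obtain a where a: "p a \<noteq> a" by (auto simp: fun_eq_iff)
    define b where "b = inv p a"
    have pb: "p b = a" unfolding b_def using less.prems(1) permutes_inverses(1) by metis
    have ab: "a \<noteq> b" using a pb by auto
    have aS: "a \<in> S" and bS: "b \<in> S"
      using less.prems(1) a pb ab by (auto dest: permutes_not_in)
    have cab: "c a = c b" using less.prems(2)[of b] pb by simp
    define p' where "p' = p \<circ> transpose a b"
    have "{x. p' x \<noteq> x} \<subseteq> {x. p x \<noteq> x} - {a}"
      using pb ab by (auto simp: p'_def transpose_def)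
    moreover have fin: "finite {x. p x \<noteq> x}"
      by (rule finite_subset[OF _ \<open>finite S\<close>]) (use less.prems(1) in \<open>auto dest: permutes_not_in\<close>)
    ultimately have "card {x. p' x \<noteq> x} < card {x. p x \<noteq> x}"
      using a by (intro psubset_card_mono) auto
    moreover have p': "p' permutes S"
      unfolding p'_def using aS bS less.prems(1) by (intro permutes_compose permutes_swap_id)
    moreover have "c (p' x) = c x" for x
      using less.prems(2) cab by (auto simp: p'_def transpose_def)
    ultimately have "P p'" by (rule less.hyps)
    then have "P (p' \<circ> transpose a b)" by (rule step[OF aS bS ab cab p'])
    then show ?thesis by (simp add: p'_def comp_assoc)
  qed
qed

section \<open>Column signs as values of polytabloids\<close>

text \<open>This is the value of the polytabloid of \<open>t\<close> at \<open>w\<close>, as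
  \<open>polytabloid_rect\<close> shows. Taking \<open>w\<close> as a function lets permutations act
  by composition.\<close>

definition col_sign :: "nat \<Rightarrow> nat \<Rightarrow> (nat \<times> nat \<Rightarrow> nat) \<Rightarrow> (nat \<Rightarrow> nat) \<Rightarrow> int" where
  "col_sign n k t w = (\<Prod>j<k. sgn_word n (\<lambda>i. w (t (i, j))))"

lemma young_diagram_rect: "young_diagram (replicate n k) = {..<n} \<times> {..<k}"
  by (auto simp: young_diagram_def)

lemma tableau_rect: "tableau (replicate n k) t \<longleftrightarrow> bij_betw t ({..<n} \<times> {..<k}) {..<n * k}"
  by (simp add: tableau_def young_diagram_rect sum_list_replicate)

lemma tableau_rect_less:
  "tableau (replicate n k) t \<Longrightarrow> i < n \<Longrightarrow> j < k \<Longrightarrow> t (i, j) < n * k"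
  using bij_betw_apply[of t "{..<n} \<times> {..<k}" "{..<n * k}" "(i, j)"] by (simp add: tableau_rect)

lemma tableau_rect_eq_iff:
  "tableau (replicate n k) t \<Longrightarrow> i < n \<Longrightarrow> j < k \<Longrightarrow> i' < n \<Longrightarrow> j' < k \<Longrightarrow>
    t (i, j) = t (i', j') \<longleftrightarrow> i = i' \<and> j = j'"
  by (auto simp: tableau_rect bij_betw_def dest: inj_onD)

lemma tableau_rectE:
  assumes "tableau (replicate n k) t" "x < n * k"
  obtains i j where "i < n" "j < k" "x = t (i, j)"
proof -
  have "x \<in> t ` ({..<n} \<times> {..<k})"
    using assms by (simp add: tableau_rect bij_betw_def)
  then show ?thesis using that by auto
qed

lemma tableau_rect_permutes:
  assumes "tableau (replicate n k) t" "p permutes {..<n * k}"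
  shows "tableau (replicate n k) (p \<circ> t)"
  using assms permutes_imp_bij[OF assms(2)] bij_betw_trans unfolding tableau_rect by blast

lemma col_sign_cong:
  assumes "tableau (replicate n k) t" "\<And>x. x < n * k \<Longrightarrow> w x = w' x"
  shows "col_sign n k t w = col_sign n k t w'"
  unfolding col_sign_def using assms tableau_rect_less
  by (intro prod.cong sgn_word_cong) auto

text \<open>Only column \<open>j\<close> contains the two exchanged entries, so exactly one factor
  changes sign.\<close>

lemma col_sign_transpose:
  assumes t: "tableau (replicate n k) t" and ij: "i1 < n" "i2 < n" "i1 \<noteq> i2" "j < k"
  shows "col_sign n k t (\<lambda>x. w (transpose (t (i1, j)) (t (i2, j)) x)) = - col_sign n k t w"
proof -
  let ?w = "\<lambda>x. w (transpose (t (i1, j)) (t (i2, j)) x)"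
  have "sgn_word n (\<lambda>i. ?w (t (i, l))) = (if l = j then -1 else 1) * sgn_word n (\<lambda>i. w (t (i, l)))"
    if l: "l < k" for l
  proof (cases "l = j")
    case True
    have "sgn_word n (\<lambda>i. ?w (t (i, l))) = sgn_word n (\<lambda>i. w (t (transpose i1 i2 i, j)))"
      using ij l True by (intro sgn_word_cong) (auto simp: transpose_def tableau_rect_eq_iff[OF t])
    then show ?thesis
      using sgn_word_transpose[OF ij(1-3), of "\<lambda>i. w (t (i, j))"] True by simp
  next
    case False
    then show ?thesis
      using ij l by (auto intro!: sgn_word_cong simp: transpose_def tableau_rect_eq_iff[OF t])
  qed
  then have "col_sign n k t ?w =
      (\<Prod>l<k. (if l = j then -1 else 1) * sgn_word n (\<lambda>i. w (t (i, l))))"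
    unfolding col_sign_def by (intro prod.cong) auto
  then show ?thesis
    using ij(4) by (simp add: prod.distrib prod.delta col_sign_def)
qed

lemma column_group_rectD:
  assumes "p \<in> column_group (replicate n k) t"
  shows "p permutes {..<n * k}"
    "i < n \<Longrightarrow> j < k \<Longrightarrow> \<exists>i'<n. p (t (i, j)) = t (i', j)"
  using assms by (auto simp: column_group_def young_diagram_rect sum_list_replicate)

text \<open>An element of the column group preserves the column number of every entry, hence is a
  product of transpositions inside columns, each of which flips the sign.\<close>

lemma col_sign_column_group:
  assumes t: "tableau (replicate n k) t" and p: "p \<in> column_group (replicate n k) t"
  shows "col_sign n k t (\<lambda>x. w (p x)) = sign p * col_sign n k t w"
proof -
  \<comment> \<open>The column number of an entry; the default 0 is harmless because
    \<open>p\<close> fixes every number from \<open>n * k\<close> on.\<close>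
  define c where "c x = (if x < n * k then snd (inv_into ({..<n} \<times> {..<k}) t x) else 0)" for x
  have c: "c (t (i, j)) = j" if "i < n" "j < k" for i j
    using t that tableau_rect_less[OF t that]
    by (simp add: c_def tableau_rect bij_betw_def inv_into_f_f)
  have "c (p x) = c x" for x
  proof (cases "x < n * k")
    case True
    then obtain i j where ij: "i < n" "j < k" "x = t (i, j)"
      using tableau_rectE[OF t] by blast
    then show ?thesis using column_group_rectD(2)[OF p ij(1,2)] c by auto
  next
    case False
    then show ?thesis
      using permutes_not_in[OF column_group_rectD(1)[OF p]] by simp
  qed
  from column_group_rectD(1)[OF p] finite_lessThan this show ?thesis
  proof (induction p rule: permutes_fibres_induct)
    case id
    then show ?case by simp
  next
    case (transpose a b p)
    obtain i1 j1 i2 j2 where *: "i1 < n" "j1 < k" "a = t (i1, j1)" "i2 < n" "j2 < k" "b = t (i2, j2)"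
      using transpose tableau_rectE[OF t] by (metis lessThan_iff)
    then have "j1 = j2" "i1 \<noteq> i2" using transpose c by auto
    then have "col_sign n k t (\<lambda>x. w ((p \<circ> Transposition.transpose a b) x)) =
        - col_sign n k t (\<lambda>x. w (p x))"
      using col_sign_transpose[OF t, of i1 i2 j1 "\<lambda>x. w (p x)"] * by simp
    moreover have "sign (p \<circ> Transposition.transpose a b) = - sign p"
      using transpose by (subst sign_compose)
        (auto simp: sign_swap_id permutation_swap_id intro: permutation_permutes[THEN iffD2])
    ultimately show ?case using transpose by (simp add: o_def)
  qed
qed

lemma tabloid_eq_iff:
  assumes t: "tableau (replicate n k) t" and w: "length w = n * k"
  shows "w = tabloid (replicate n k) t \<longleftrightarrow> (\<forall>i<n. \<forall>j<k. w ! t (i, j) = i)"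
proof -
  have inv: "fst (inv_into ({..<n} \<times> {..<k}) t (t (i, j))) = i" if "i < n" "j < k" for i j
    using t that by (simp add: tableau_rect bij_betw_def inv_into_f_f)
  have "w = tabloid (replicate n k) t \<longleftrightarrow>
      (\<forall>x<n * k. w ! x = fst (inv_into ({..<n} \<times> {..<k}) t x))"
    using w by (auto simp: list_eq_iff_nth_eq tabloid_def young_diagram_rect sum_list_replicate)
  also have "\<dots> \<longleftrightarrow> (\<forall>i<n. \<forall>j<k. w ! t (i, j) = i)"
  proof (intro iffI allI impI)
    fix x assume *: "\<forall>i<n. \<forall>j<k. w ! t (i, j) = i" and "x < n * k"
    then obtain i j where ij: "i < n" "j < k" "x = t (i, j)"
      using tableau_rectE[OF t] by blast
    then show "w ! x = fst (inv_into ({..<n} \<times> {..<k}) t x)" using * inv by simp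
  next
    fix i j assume "\<forall>x<n * k. w ! x = fst (inv_into ({..<n} \<times> {..<k}) t x)" "i < n" "j < k"
    then show "w ! t (i, j) = i" using tableau_rect_less[OF t] inv by simp
  qed
  finally show ?thesis .
qed

text \<open>Only the set \<open>A\<close> of those \<open>p\<close> that turn \<open>t\<close> into
  a tableau of the tabloid \<open>w\<close> contributes. All of them have the same sign, and
  \<open>A\<close> is a singleton if every column of \<open>t\<close> reads a permutation in
  \<open>w\<close>.\<close>

lemma polytabloid_rect:
  assumes t: "tableau (replicate n k) t" and w: "length w = n * k"
  shows "polytabloid (replicate n k) t w = of_int (col_sign n k t ((!) w))"
proof -
  let ?C = "column_group (replicate n k) t"
  define A where "A = {p \<in> ?C. \<forall>i<n. \<forall>j<k. w ! p (t (i, j)) = i}"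
  have finC: "finite ?C"
    by (rule finite_subset[OF _ finite_permutations[of "{..<n * k}"]])
      (use column_group_rectD(1) in auto)
  have tab: "w = tabloid (replicate n k) (p \<circ> t) \<longleftrightarrow> p \<in> A" if "p \<in> ?C" for p
    using tabloid_eq_iff[OF tableau_rect_permutes[OF t column_group_rectD(1)[OF that]] w] that
    by (simp add: A_def)
  have sgn: "sign p = col_sign n k t ((!) w)" if "p \<in> A" for p
  proof -
    \<comment> \<open>For \<open>p\<close> in \<open>A\<close>, every column of
      \<open>p \<circ> t\<close> reads the identity.\<close>
    have "col_sign n k t (\<lambda>x. w ! p x) = (\<Prod>j<k. sign (id :: nat \<Rightarrow> nat))"
      unfolding col_sign_def using that
      by (intro prod.cong refl sgn_word_permutes permutes_id) (auto simp: A_def)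
    then have "sign p * col_sign n k t ((!) w) = 1"
      using col_sign_column_group[OF t, of p "(!) w"] that by (simp add: A_def)
    then show ?thesis by (cases p rule: sign_cases) auto
  qed
  have "polytabloid (replicate n k) t w = (\<Sum>p\<in>?C. if p \<in> A then of_int (sign p) else 0)"
    unfolding polytabloid_def by (intro sum.cong) (auto simp: tab)
  also have "\<dots> = (\<Sum>p\<in>A. of_int (sign p))"
    using finC by (subst sum.inter_restrict[symmetric]) (auto simp: A_def intro!: sum.cong)
  also have "\<dots> = of_nat (card A) * of_int (col_sign n k t ((!) w))"
    using sgn by simp
  also have "\<dots> = of_int (col_sign n k t ((!) w))"
  \<comment> \<open>If the column sign is 0, both sides vanish whatever the size of
    \<open>A\<close>; otherwise \<open>A\<close> must be shown to have one element.\<close>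
  proof (cases "col_sign n k t ((!) w) = 0")
    case False
    have "\<exists>\<sigma>. \<sigma> permutes {..<n} \<and> (\<forall>i<n. w ! t (i, j) = \<sigma> i)" if "j < k" for j
    proof -
      have "sgn_word n (\<lambda>i. w ! t (i, j)) \<noteq> 0"
        using False that by (auto simp: col_sign_def)
      then obtain \<tau> where "\<tau> permutes {..<n}" "\<And>i. i < n \<Longrightarrow> w ! t (i, j) = \<tau> i"
        by (rule sgn_word_nonzeroE) blast
      then show ?thesis by blast
    qed
    then have "\<forall>j. \<exists>\<sigma>. j < k \<longrightarrow> \<sigma> permutes {..<n} \<and> (\<forall>i<n. w ! t (i, j) = \<sigma> i)"
      by blast
    from choice[OF this] obtain \<sigma> where \<sigma>: "\<And>j. j < k \<Longrightarrow> \<sigma> j permutes {..<n}"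
      "\<And>i j. i < n \<Longrightarrow> j < k \<Longrightarrow> w ! t (i, j) = \<sigma> j i"
      by blast
    \<comment> \<open>The only candidate: \<open>p\<close> sends the entry in cell
      \<open>(i, j)\<close> to the entry of column \<open>j\<close> that carries the letter
      \<open>i\<close>, which sits in row \<open>inv (\<sigma> j) i\<close>.\<close>
    define s where "s = inv_into ({..<n} \<times> {..<k}) t"
    define f where "f = (\<lambda>(i, j). (inv (\<sigma> j) i, j))"
    define p where "p x = (if x < n * k then t (f (s x)) else x)" for x
    have inv\<sigma>: "inv (\<sigma> j) i < n" if "i < n" "j < k" for i j
      using permutes_in_image[OF permutes_inv[OF \<sigma>(1)], of j i] that by simp
    have "bij_betw f ({..<n} \<times> {..<k}) ({..<n} \<times> {..<k})"
      by (rule bij_betw_byWitness[where f' = "\<lambda>(i, j). (\<sigma> j i, j)"])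
        (use \<sigma>(1) inv\<sigma> permutes_in_image[OF \<sigma>(1)] in
          \<open>auto simp: f_def permutes_inverses[OF \<sigma>(1)]\<close>)
    moreover have bt: "bij_betw t ({..<n} \<times> {..<k}) {..<n * k}" using t by (simp add: tableau_rect)
    moreover have "bij_betw s {..<n * k} ({..<n} \<times> {..<k})"
      unfolding s_def by (rule bij_betw_inv_into[OF bt])
    ultimately have "bij_betw (t \<circ> (f \<circ> s)) {..<n * k} {..<n * k}"
      using bij_betw_trans by metis
    then have "bij_betw p {..<n * k} {..<n * k}"
      by (subst bij_betw_cong[of _ _ "t \<circ> (f \<circ> s)"]) (auto simp: p_def)
    then have "p permutes {..<n * k}"
      by (rule bij_imp_permutes) (simp add: p_def)
    moreover have pt: "p (t (i, j)) = t (inv (\<sigma> j) i, j)" if "i < n" "j < k" for i j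
      using that tableau_rect_less[OF t that] bt
      by (simp add: p_def s_def f_def bij_betw_def inv_into_f_f)
    ultimately have "p \<in> ?C"
      using inv\<sigma> unfolding column_group_def young_diagram_rect sum_list_replicate by fastforce
    then have pA: "p \<in> A"
      using pt \<sigma>(2) inv\<sigma> permutes_inverses(1)[OF \<sigma>(1)] by (auto simp: A_def)
    have "q = p" if q: "q \<in> A" for q
    proof
      fix x
      show "q x = p x"
      proof (cases "x < n * k")
        case True
        then obtain i j where ij: "i < n" "j < k" "x = t (i, j)"
          using tableau_rectE[OF t] by blast
        have qC: "q \<in> ?C" using q by (simp add: A_def)
        obtain i' where i': "i' < n" "q x = t (i', j)"
          using column_group_rectD(2)[OF qC ij(1,2)] ij by auto
        have "w ! q x = i" using q ij by (simp add: A_def)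
        then have "\<sigma> j i' = i" using i' \<sigma>(2)[OF i'(1) ij(2)] by simp
        then have "i' = inv (\<sigma> j) i" using permutes_inverses(2)[OF \<sigma>(1)[OF ij(2)]] by metis
        then show ?thesis using i' pt ij by simp
      next
        case False
        have "q permutes {..<n * k}" using q by (intro column_group_rectD(1)[of _ n k t]) (simp add: A_def)
        then show ?thesis using False permutes_not_in[of q "{..<n * k}" x] by (simp add: p_def)
      qed
    qed
    then have "A = {p}" using pA by blast
    then show ?thesis by simp
  qed simp
  finally show ?thesis .
qed

lemma polytabloid_rect_eq_0:
  assumes t: "tableau (replicate n k) t" and w: "\<not> (length w = n * k \<and> set w \<subseteq> {..<n})"
  shows "polytabloid (replicate n k) t w = 0"
proof -
  have "w \<noteq> tabloid (replicate n k) (p \<circ> t)" if "p \<in> column_group (replicate n k) t" for p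
  proof -
    have "tableau (replicate n k) (p \<circ> t)"
      using tableau_rect_permutes[OF t column_group_rectD(1)[OF that]] .
    then have "inv_into ({..<n} \<times> {..<k}) (p \<circ> t) x \<in> {..<n} \<times> {..<k}" if "x < n * k" for x
      using that by (intro inv_into_into) (auto simp: tableau_rect bij_betw_def)
    then show ?thesis
      using w by (fastforce simp: tabloid_def young_diagram_rect sum_list_replicate)
  qed
  then show ?thesis by (auto simp: polytabloid_def intro!: sum.neutral)
qed

section \<open>Invariants in tensor powers of rectangular Specht modules\<close>

lemma linear_tabloid_action: "Vector_Spaces.linear cscale cscale (tabloid_action p)"
  unfolding Vector_Spaces.linear_iff
  by (intro conjI cfun.vector_space_axioms) (auto simp: tabloid_action_def cscale_def)

lemma linear_diagonal_action: "Vector_Spaces.linear cscale cscale (diagonal_action p)"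
  unfolding Vector_Spaces.linear_iff
  by (intro conjI cfun.vector_space_axioms) (auto simp: diagonal_action_def cscale_def)

lemma subspace_supported: "cfun.subspace {f. \<forall>x. x \<notin> A \<longrightarrow> f x = 0}"
  by (auto simp: cfun.subspace_def cscale_def)

lemma supported_subset_span:
  assumes "finite A"
  shows "{f. \<forall>x. x \<notin> A \<longrightarrow> f x = 0} \<subseteq> cfun.span ((\<lambda>a x. if x = a then 1 else 0) ` A)"
proof safe
  fix f :: "'a \<Rightarrow> complex" assume f: "\<forall>x. x \<notin> A \<longrightarrow> f x = 0"
  have "f = (\<Sum>a\<in>A. cscale (f a) (\<lambda>x. if x = a then 1 else 0))"
  proof
    fix x
    have "(\<Sum>a\<in>A. cscale (f a) (\<lambda>x. if x = a then 1 else 0)) x = (\<Sum>a\<in>A. if x = a then f a else 0)"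
      unfolding sum_apply cscale_def by (intro sum.cong) auto
    then show "f x = (\<Sum>a\<in>A. cscale (f a) (\<lambda>x. if x = a then 1 else 0)) x"
      using f assms by simp
  qed
  also have "\<dots> \<in> cfun.span ((\<lambda>a x. if x = a then 1 else 0) ` A)"
    by (intro cfun.span_sum cfun.span_scale cfun.span_base) auto
  finally show "f \<in> cfun.span ((\<lambda>a x. if x = a then 1 else 0) ` A)" .
qed

text \<open>The finite support of the rectangular Specht module. It gives finite dimensionality and
  excludes words of the wrong length.\<close>

definition words :: "nat \<Rightarrow> nat \<Rightarrow> nat list set" where
  "words n N = {w. length w = N \<and> set w \<subseteq> {..<n}}"

lemma finite_words: "finite (words n N)"
  using finite_lists_length_eq[of "{..<n}" N] by (simp add: words_def conj_commute)

lemma specht_rect_supported: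
  assumes "f \<in> specht_module (replicate n k)" "w \<notin> words n (n * k)"
  shows "f w = 0"
proof -
  have "specht_module (replicate n k) \<subseteq> {f. \<forall>w. w \<notin> words n (n * k) \<longrightarrow> f w = 0}"
    unfolding specht_module_def
    by (intro cfun.span_minimal subspace_supported) (simp add: image_subset_iff words_def polytabloid_rect_eq_0)
  then show ?thesis using assms by blast
qed

lemma tabloid_action_polytabloid:
  assumes t: "tableau (replicate n k) t" and p: "p permutes {..<n * k}"
  shows "tabloid_action p (polytabloid (replicate n k) t) = polytabloid (replicate n k) (p \<circ> t)"
proof
  fix w
  note pt = tableau_rect_permutes[OF t p]
  show "tabloid_action p (polytabloid (replicate n k) t) w = polytabloid (replicate n k) (p \<circ> t) w"
  proof (cases "length w = n * k")
    case True
    \<comment> \<open>Reading the permuted word along \<open>t\<close> is reading \<open>w\<close>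
      along \<open>p \<circ> t\<close>.\<close>
    have "col_sign n k t ((!) (permute_list p w)) = col_sign n k t (\<lambda>x. w ! p x)"
      using True p by (intro col_sign_cong[OF t] permute_list_nth) auto
    then show ?thesis
      using True by (simp add: tabloid_action_def polytabloid_rect[OF t] polytabloid_rect[OF pt])
        (simp add: col_sign_def)
  next
    case False
    then show ?thesis
      by (simp add: tabloid_action_def polytabloid_rect_eq_0[OF t] polytabloid_rect_eq_0[OF pt])
  qed
qed

lemma specht_rect_stable:
  assumes p: "p permutes {..<n * k}" and f: "f \<in> specht_module (replicate n k)"
  shows "tabloid_action p f \<in> specht_module (replicate n k)"
proof -
  have "tabloid_action p ` specht_module (replicate n k) =
      cfun.span (tabloid_action p ` polytabloid (replicate n k) ` {t. tableau (replicate n k) t})"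
    unfolding specht_module_def
    by (rule cfun_pair.linear_span_image[OF linear_tabloid_action, symmetric])
  also have "\<dots> \<subseteq> specht_module (replicate n k)"
    unfolding specht_module_def
    using tableau_rect_permutes[OF _ p]
    by (intro cfun.span_mono) (auto simp: tabloid_action_polytabloid[OF _ p])
  finally show ?thesis using f by blast
qed

lemma diagonal_action_elementary_tensor:
  "diagonal_action p (elementary_tensor fs) = elementary_tensor (map (tabloid_action p) fs)"
  by (auto simp: diagonal_action_def elementary_tensor_def tabloid_action_def fun_eq_iff)

lemma tensor_rect_supported:
  assumes "F \<in> tensor_product (replicate d (specht_module (replicate n k)))"
    and "\<not> (length ws = d \<and> set ws \<subseteq> words n (n * k))"
  shows "F ws = 0"
proof -
  let ?A = "{ws. length ws = d \<and> set ws \<subseteq> words n (n * k)}"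
  have "elementary_tensor fs ws = 0"
    if fs: "list_all2 (\<in>) fs (replicate d (specht_module (replicate n k)))" and ws: "ws \<notin> ?A" for fs ws
  proof (cases "length ws = length fs")
    case True
    have d: "length fs = d" using list_all2_lengthD[OF fs] by simp
    then obtain i where i: "i < d" "ws ! i \<notin> words n (n * k)"
      using ws True by (auto simp: subset_iff in_set_conv_nth)
    moreover have "fs ! i \<in> specht_module (replicate n k)"
      using list_all2_nthD[OF fs, of i] i d by simp
    ultimately have "(fs ! i) (ws ! i) = 0" by (simp add: specht_rect_supported)
    then show ?thesis using i d by (auto simp: elementary_tensor_def intro!: prod_zero)
  qed (simp add: elementary_tensor_def)
  then have "tensor_product (replicate d (specht_module (replicate n k))) \<subseteq> {F. \<forall>ws. ws \<notin> ?A \<longrightarrow> F ws = 0}"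
    unfolding tensor_product_def by (intro cfun.span_minimal subspace_supported) auto
  then show ?thesis using assms by blast
qed

lemma representation_tensor_rect:
  "representation (n * k) diagonal_action (tensor_product (replicate d (specht_module (replicate n k))))"
    (is "representation ?N _ ?V")
proof -
  let ?fs = "{fs. list_all2 (\<in>) fs (replicate d (specht_module (replicate n k)))}"
  have "diagonal_action p ` ?V \<subseteq> ?V" if p: "p permutes {..<?N}" for p
  proof -
    have "diagonal_action p ` ?V = cfun.span (diagonal_action p ` elementary_tensor ` ?fs)"
      unfolding tensor_product_def
      by (rule cfun_pair.linear_span_image[OF linear_diagonal_action, symmetric])
    also have "\<dots> \<subseteq> ?V"
      unfolding tensor_product_def
      by (intro cfun.span_mono)
        (auto simp: diagonal_action_elementary_tensor list_all2_conv_all_nth specht_rect_stable[OF p])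
    finally show ?thesis .
  qed
  then have "stable_subspace ?N diagonal_action ?V"
    by (auto simp: stable_subspace_def tensor_product_def)
  moreover have "\<exists>S. finite S \<and> ?V \<subseteq> cfun.span S"
  proof -
    let ?A = "{ws. set ws \<subseteq> words n ?N \<and> length ws = d}"
    have fin: "finite ?A" by (rule finite_lists_length_eq[OF finite_words])
    have "?V \<subseteq> {F. \<forall>ws. ws \<notin> ?A \<longrightarrow> F ws = 0}"
      using tensor_rect_supported by blast
    also note supported_subset_span[OF fin]
    finally show ?thesis using fin by (intro exI[of _ "(\<lambda>a x. if x = a then 1 else 0) ` ?A"]) simp
  qed
  moreover have "diagonal_action (p \<circ> q) F = diagonal_action p (diagonal_action q F)"
    if F: "F \<in> ?V" and pq: "p permutes {..<?N}" "q permutes {..<?N}" for p q F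
  proof
    fix ws
    show "diagonal_action (p \<circ> q) F ws = diagonal_action p (diagonal_action q F) ws"
    proof (cases "\<forall>w\<in>set ws. length w = ?N")
      case True
      then show ?thesis
        using pq(2) by (auto simp: diagonal_action_def o_def permute_list_compose[unfolded o_def]
          intro!: arg_cong[of _ _ F])
    next
      case False
      then obtain w where w: "w \<in> set ws" "length w \<noteq> ?N" by blast
      \<comment> \<open>\<open>permute_list\<close> preserves lengths, so a word of the wrong length
        stays one and both sides are 0; \<open>r\<close> stands for the single and for the iterated
        permutation.\<close>
      have "F (map r ws) = 0" if "length (r w) = length w" for r
      proof (rule tensor_rect_supported[OF F])
        have "r w \<in> set (map r ws)" "r w \<notin> words n ?N" using w that by (auto simp: words_def)
        then show "\<not> (length (map r ws) = d \<and> set (map r ws) \<subseteq> words n ?N)" by blast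
      qed
      from this[of "permute_list (p \<circ> q)"] this[of "permute_list q \<circ> permute_list p"]
      have "F (map (permute_list (p \<circ> q)) ws) = 0" "F (map (permute_list q) (map (permute_list p) ws)) = 0"
        by simp_all
      then show ?thesis by (simp add: diagonal_action_def)
    qed
  qed
  moreover have "diagonal_action id F = F" for F
    by (rule ext) (simp add: diagonal_action_def map_idI)
  ultimately show ?thesis
    by (simp add: representation_def linear_diagonal_action)
qed

text \<open>One row is the rectangle with \<open>n = 1\<close>: its columns have height one, so each
  polytabloid is the indicator of the zero word.\<close>

lemma specht_one_row:
  "specht_module [N] = cfun.span {\<lambda>w. if w = replicate N 0 then 1 else 0}"
proof -
  have "polytabloid [N] t = (\<lambda>w. if w = replicate N 0 then 1 else 0)" if t: "tableau [N] t" for t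
  proof
    fix w
    have t': "tableau (replicate 1 N) t" using t by simp
    show "polytabloid [N] t w = (if w = replicate N 0 then 1 else 0)"
    proof (cases "length w = N \<and> set w \<subseteq> {..<1}")
      case True
      then have w: "w = replicate N 0" by (auto intro!: replicate_eqI)
      have "col_sign 1 N t ((!) w) = (\<Prod>j<N. sign (id :: nat \<Rightarrow> nat))"
        unfolding col_sign_def using tableau_rect_less[OF t'] w
        by (intro prod.cong refl sgn_word_permutes permutes_id) auto
      then show ?thesis using polytabloid_rect[OF t', of w] w by simp
    next
      case False
      then show ?thesis using polytabloid_rect_eq_0[OF t', of w] by auto
    qed
  qed
  \<comment> \<open>Some tableau must exist, as otherwise the span would be zero.\<close>
  moreover have "tableau [N] (\<lambda>(i, j). j)"
  proof -
    have "tableau (replicate 1 N) (\<lambda>(i, j). j)"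
      unfolding tableau_rect by (rule bij_betw_byWitness[where f' = "\<lambda>j. (0, j)"]) auto
    then show ?thesis by simp
  qed
  ultimately have "polytabloid [N] ` {t. tableau [N] t} = {\<lambda>w. if w = replicate N 0 then 1 else 0}"
    by (auto simp: image_iff)
  then show ?thesis by (simp add: specht_module_def)
qed

section \<open>Positivity criterion from column signs\<close>

text \<open>At \<open>d\<close> copies of \<open>w\<close>, the summand of \<open>p\<close> in the
  symmetrization is the product of column signs at \<open>w\<close> composed with \<open>p\<close>.
  Since \<open>nonneg\<close> covers every \<open>g\<close>, no cancellation can occur, and
  \<open>pos\<close> makes the term of the identity positive.\<close>

theorem kronecker_rect_pos:
  assumes t: "\<And>i. i < d \<Longrightarrow> tableau (replicate n k) (t i)"
    and nonneg: "\<And>g. 0 \<le> (\<Prod>i<d. col_sign n k (t i) g)"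
    and pos: "length w = n * k" "0 < (\<Prod>i<d. col_sign n k (t i) ((!) w))"
  shows "rect_kronecker_coeff d n k > 0"
proof -
  let ?N = "n * k" and ?V = "tensor_product (replicate d (specht_module (replicate n k)))"
  define G where "G = {p. p permutes {..<?N}}"
  define fs where "fs = map (\<lambda>i. polytabloid (replicate n k) (t i)) [0..<d]"
  define F where "F = (\<Sum>p\<in>G. diagonal_action p (elementary_tensor fs))"
  note V = representation_tensor_rect[of n k d]
  have finG: "finite G" by (simp add: G_def finite_permutations)
  have E: "elementary_tensor fs \<in> ?V"
    unfolding tensor_product_def fs_def
    by (intro cfun.span_base imageI)
      (auto simp: list_all2_conv_all_nth specht_module_def intro!: cfun.span_base t)
  have "F \<in> ?V"
    unfolding F_def
  proof (rule cfun.subspace_sum[OF representationD(2)[OF V]])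
    fix p assume "p \<in> G"
    then show "diagonal_action p (elementary_tensor fs) \<in> ?V"
      using representationD(1)[OF V] E unfolding stable_subspace_def G_def by blast
  qed
  moreover have "diagonal_action q F = F" if q: "q permutes {..<?N}" for q
  proof -
    \<comment> \<open>By the composition law, acting with \<open>q\<close> only permutes the
      summands through left multiplication.\<close>
    have "diagonal_action q F = (\<Sum>p\<in>G. diagonal_action (q \<circ> p) (elementary_tensor fs))"
      unfolding F_def cfun_pair.linear_sum[OF linear_diagonal_action]
      using representationD(6)[OF V E q] by (intro sum.cong) (auto simp: G_def)
    also have "\<dots> = F"
      unfolding F_def
      by (rule sum.reindex_bij_witness[of _ "\<lambda>p. inv q \<circ> p" "\<lambda>p. q \<circ> p"])
        (use q in \<open>auto simp: G_def permutes_compose permutes_inv o_assoc permutes_inv_o\<close>)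
    finally show ?thesis .
  qed
  ultimately have "F \<in> invariants ?N diagonal_action ?V"
    by (simp add: invariants_def)
  moreover have "F \<noteq> 0"
  proof -
    have val: "diagonal_action p (elementary_tensor fs) (replicate d w) =
        of_int (\<Prod>i<d. col_sign n k (t i) (\<lambda>x. w ! p x))" if "p \<in> G" for p
    proof -
      have "diagonal_action p (elementary_tensor fs) (replicate d w) =
          (\<Prod>i<d. polytabloid (replicate n k) (t i) (permute_list p w))"
        by (simp add: diagonal_action_def elementary_tensor_def fs_def)
      also have "\<dots> = (\<Prod>i<d. of_int (col_sign n k (t i) (\<lambda>x. w ! p x)))"
      proof (rule prod.cong[OF refl])
        fix i assume "i \<in> {..<d}"
        then have ti: "tableau (replicate n k) (t i)" using t by simp
        have "col_sign n k (t i) ((!) (permute_list p w)) = col_sign n k (t i) (\<lambda>x. w ! p x)"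
          using that pos(1) by (intro col_sign_cong[OF ti] permute_list_nth) (auto simp: G_def)
        then show "polytabloid (replicate n k) (t i) (permute_list p w) =
            of_int (col_sign n k (t i) (\<lambda>x. w ! p x))"
          using polytabloid_rect[OF ti, of "permute_list p w"] pos(1) by simp
      qed
      finally show ?thesis by simp
    qed
    have "F (replicate d w) = of_int (\<Sum>p\<in>G. \<Prod>i<d. col_sign n k (t i) (\<lambda>x. w ! p x))"
      unfolding F_def sum_apply using val by simp
    moreover have "0 < (\<Sum>p\<in>G. \<Prod>i<d. col_sign n k (t i) (\<lambda>x. w ! p x))"
    proof (rule sum_pos2[OF finG, of id])
      show "id \<in> G" by (simp add: G_def permutes_id)
    qed (use pos nonneg in auto)
    ultimately have "F (replicate d w) \<noteq> 0" by (metis of_int_eq_0_iff less_irrefl)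
    then show ?thesis by auto
  qed
  moreover have "(\<lambda>w. if w = replicate ?N 0 then 1 else 0) \<noteq> (0 :: nat list \<Rightarrow> complex)"
    by (auto simp: fun_eq_iff)
  moreover have "tabloid_action p (\<lambda>w. if w = replicate ?N 0 then 1 else 0) =
      (\<lambda>w. if w = replicate ?N 0 then 1 else 0)" if p: "p permutes {..<?N}" for p
  proof -
    \<comment> \<open>For words of length \<open>?N\<close> the set of letters is preserved; for
      other lengths both equations fail.\<close>
    have "permute_list p w = replicate ?N 0 \<longleftrightarrow> w = replicate ?N 0" for w :: "nat list"
    proof (cases "length w = ?N")
      case True
      then have "mset (permute_list p w) = mset w" using p by simp
      then have "set (permute_list p w) = set w" by (metis set_mset_mset)
      then show ?thesis using True
        by (metis in_set_replicate length_permute_list length_replicate replicate_eqI)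
    qed (metis length_permute_list length_replicate)
    then show ?thesis by (simp add: tabloid_action_def)
  qed
  ultimately show ?thesis
    unfolding rect_kronecker_coeff_def kronecker_coeff_def specht_one_row map_replicate
    using linear_tabloid_action by (intro multiplicity_trivial_pos[OF V, of _ _ F]) auto
qed

section \<open>Twisted tableaux\<close>

definition swap_parity :: "nat \<Rightarrow> nat" where
  "swap_parity j = (if even j then j + 1 else j - 1)"

lemma swap_parity_swap_parity [simp]: "swap_parity (swap_parity j) = j"
  by (auto simp: swap_parity_def)

lemma swap_parity_less: "even k \<Longrightarrow> j < k \<Longrightarrow> swap_parity j < k"
  by (auto simp: swap_parity_def) presburger

definition twisted_tableau :: "nat \<Rightarrow> nat \<Rightarrow> nat \<times> nat \<Rightarrow> nat" where
  "twisted_tableau k m = (\<lambda>(r, j). r * k + (if bit r m then swap_parity j else j))"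

lemma tableau_twisted:
  assumes "even k"
  shows "tableau (replicate n k) (twisted_tableau k m)"
proof (cases "k = 0")
  case False
  let ?f = "\<lambda>r j. if bit r m then swap_parity j else j"
  have f: "?f r j < k" if "j < k" for r j using that assms by (simp add: swap_parity_less)
  have div: "(r * k + j) div k = r" "(r * k + j) mod k = j" if "j < k" for r j
    using that by auto
  have less: "r * k + j < n * k" if "r < n" "j < k" for r j
  proof -
    have "r * k + j < Suc r * k" using that by simp
    also have "\<dots> \<le> n * k" using that by (intro mult_le_mono1) simp
    finally show ?thesis .
  qed
  show ?thesis
    unfolding tableau_rect
  \<comment> \<open>Twisting stays within rows, so division by \<open>k\<close> recovers the row,
    and the same twist undoes itself.\<close>
  proof (rule bij_betw_byWitness[where f' = "\<lambda>x. (x div k, ?f (x div k) (x mod k))"])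
    show "\<forall>a\<in>{..<n} \<times> {..<k}. (twisted_tableau k m a div k,
        ?f (twisted_tableau k m a div k) (twisted_tableau k m a mod k)) = a"
      using assms by (auto simp: twisted_tableau_def div swap_parity_less)
    show "\<forall>x\<in>{..<n * k}. twisted_tableau k m (x div k, ?f (x div k) (x mod k)) = x"
      by (auto simp: twisted_tableau_def)
    show "twisted_tableau k m ` ({..<n} \<times> {..<k}) \<subseteq> {..<n * k}"
      using f less by (auto simp: twisted_tableau_def)
    show "(\<lambda>x. (x div k, ?f (x div k) (x mod k))) ` {..<n * k} \<subseteq> {..<n} \<times> {..<k}"
      using f False assms by (auto simp: less_mult_imp_div_less swap_parity_less)
  qed
qed (simp add: tableau_rect bij_betw_def)

text \<open>The factors at \<open>2 * a\<close> and \<open>2 * a + 1\<close> agree, so the product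
  is one of squares.\<close>

lemma prod_pairs_nonneg:
  fixes s :: "nat \<Rightarrow> int"
  assumes "even k" "\<And>j. j < k \<Longrightarrow> s (swap_parity j) = s j"
  shows "0 \<le> (\<Prod>j<k. s j)"
proof -
  obtain a where "k = 2 * a" using assms(1) by blast
  with assms(2) show ?thesis
  proof (induction a arbitrary: k)
    case (Suc a)
    have "0 \<le> (\<Prod>j<2 * a. s j)" using Suc by auto
    moreover have "s (2 * a + 1) = s (2 * a)"
      using Suc.prems(1)[of "2 * a"] Suc.prems(2) by (simp add: swap_parity_def)
    ultimately show ?case using Suc.prems(2) by (simp add: mult.assoc)
  qed simp
qed

lemma col_sign_twisted_prod_nonneg:
  assumes "even k" and "0 < d" and n: "n \<le> 2 ^ (d - 1)"
  shows "0 \<le> (\<Prod>m<d. col_sign n k (twisted_tableau k m) g)"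
proof (cases "\<exists>m<d. col_sign n k (twisted_tableau k m) g = 0")
  case True
  then have "(\<Prod>m<d. col_sign n k (twisted_tableau k m) g) = 0" by (intro prod_zero) auto
  then show ?thesis by (simp only: order.refl)
next
  case False
  \<comment> \<open>With all factors nonzero, \<open>g\<close> reads a permutation along every
    column of every tableau.\<close>
  have col: "\<exists>\<sigma>. \<sigma> permutes {..<n} \<and> (\<forall>r<n. g (twisted_tableau k m (r, j)) = \<sigma> r)"
    if "m < d" "j < k" for m j
  proof -
    have "sgn_word n (\<lambda>r. g (twisted_tableau k m (r, j))) \<noteq> 0"
      using False that by (auto simp: col_sign_def)
    then obtain \<tau> where "\<tau> permutes {..<n}" "\<And>r. r < n \<Longrightarrow> g (twisted_tableau k m (r, j)) = \<tau> r"
      by (rule sgn_word_nonzeroE) blast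
    then show ?thesis by blast
  qed
  have inj: "r = r'" if "m < d" "j < k" "r < n" "r' < n"
    "g (twisted_tableau k m (r, j)) = g (twisted_tableau k m (r', j))" for m j r r'
    using col[OF that(1,2)] that(3-5) by (auto dest: permutes_inj simp: inj_eq)
  \<comment> \<open>Row numbers only use the bits below \<open>d - 1\<close>. So the tableau with
    \<open>m = d - 1\<close> is untwisted, and any bit separating two rows belongs to one of the
    \<open>d\<close> tableaux.\<close>
  have nobit: "\<not> bit r m" if "r < n" "d - 1 \<le> m" for r m
  proof -
    have "(2 :: nat) ^ (d - 1) \<le> 2 ^ m"
      using that(2) by (rule power_increasing) simp
    then have "r < 2 ^ m" using that(1) n by linarith
    then show ?thesis by (simp add: bit_iff_odd)
  qed
  have eq: "g (r * k + j) = g (r * k + swap_parity j)" if r: "r < n" and j: "j < k" for r j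
  proof -
    have j': "swap_parity j < k" using j assms(1) by (rule swap_parity_less[rotated])
    obtain \<sigma> where \<sigma>: "\<sigma> permutes {..<n}" "\<And>r. r < n \<Longrightarrow> g (r * k + j) = \<sigma> r"
      using col[of "d - 1" j] \<open>0 < d\<close> j nobit by (auto simp: twisted_tableau_def)
    obtain \<tau> where \<tau>: "\<tau> permutes {..<n}" "\<And>r. r < n \<Longrightarrow> g (r * k + swap_parity j) = \<tau> r"
      using col[of "d - 1" "swap_parity j"] \<open>0 < d\<close> j' nobit by (auto simp: twisted_tableau_def)
    \<comment> \<open>The row in which the partner column carries the letter found at
      \<open>(r, j)\<close>.\<close>
    define r' where "r' = inv \<tau> (\<sigma> r)"
    have r': "r' < n"
      using permutes_in_image[OF permutes_inv[OF \<tau>(1)], of "\<sigma> r"] permutes_in_image[OF \<sigma>(1), of r] r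
      by (simp add: r'_def)
    have g: "g (r * k + j) = g (r' * k + swap_parity j)"
      using \<sigma>(2)[OF r] \<tau>(2)[OF r'] permutes_inverses(1)[OF \<tau>(1)] by (simp add: r'_def)
    have "r = r'"
    proof (rule ccontr)
      assume "r \<noteq> r'"
      then obtain m where m: "bit r m \<noteq> bit r' m" using bit_eqI by blast
      then have "m < d" using nobit[OF r, of m] nobit[OF r', of m] by linarith
      have "r = r'"
      \<comment> \<open>Twisting exactly one of the two rows puts both occurrences into one column
        of tableau \<open>m\<close>: column \<open>swap_parity j\<close> if row \<open>r\<close> is
        the twisted one, column \<open>j\<close> otherwise.\<close>
      proof (cases "bit r m")
        case True
        then show ?thesis
          using inj[OF \<open>m < d\<close> j' r r'] m g by (simp add: twisted_tableau_def)
      next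
        case False
        then show ?thesis
          using inj[OF \<open>m < d\<close> j r r'] m g by (simp add: twisted_tableau_def)
      qed
      then show False using \<open>r \<noteq> r'\<close> by blast
    qed
    then show ?thesis using g by simp
  qed
  have "0 \<le> col_sign n k (twisted_tableau k m) g" for m
  proof -
    \<comment> \<open>As \<open>g\<close> agrees on partner columns, it does not see the
      twist.\<close>
    have "col_sign n k (twisted_tableau k m) g = (\<Prod>j<k. sgn_word n (\<lambda>r. g (r * k + j)))"
      unfolding col_sign_def using eq
      by (intro prod.cong refl sgn_word_cong) (auto simp: twisted_tableau_def)
    also have "\<dots> \<ge> 0"
      using eq by (intro prod_pairs_nonneg[OF assms(1)] sgn_word_cong) simp
    finally show ?thesis .
  qed
  then show ?thesis by (intro prod_nonneg) simp
qed

theorem theorem1p13: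
  fixes d n k :: nat
  assumes "d \<ge> 3" and "odd d" and "k > 0" and "even k" and "n \<le> 2 ^ (d - 1)"
  shows "rect_kronecker_coeff d n k > 0"
proof (rule kronecker_rect_pos)
  let ?w = "map (\<lambda>x. x div k) [0..<n * k]"
  show tab: "tableau (replicate n k) (twisted_tableau k m)" for m
    by (rule tableau_twisted[OF assms(4)])
  show "0 \<le> (\<Prod>m<d. col_sign n k (twisted_tableau k m) g)" for g
    using assms by (intro col_sign_twisted_prod_nonneg) auto
  show "length ?w = n * k" by simp
  \<comment> \<open>\<open>?w\<close> gives each entry its row number, and twisting never leaves a
    row; so every column reads the identity and every factor is 1.\<close>
  have "col_sign n k (twisted_tableau k m) ((!) ?w) = (\<Prod>j<k. sign (id :: nat \<Rightarrow> nat))" for m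
    unfolding col_sign_def
  proof (intro prod.cong refl sgn_word_permutes permutes_id)
    fix j r assume "j \<in> {..<k}" and r: "r < n"
    then have "j < k" "swap_parity j < k" using assms(4) swap_parity_less by auto
    then show "?w ! twisted_tableau k m (r, j) = id r"
      using tableau_rect_less[OF tab r, of j m] by (auto simp: twisted_tableau_def)
  qed
  then show "0 < (\<Prod>m<d. col_sign n k (twisted_tableau k m) ((!) ?w))" by simp
qed

end
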